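(* Let $G=(V,E,F)$ be a finite planar graph and let $a$ be a positive number with $a\le \inf_{\sigma\in F}\frac{2\pi}{\deg(\sigma)}$. Then $$\mathrm{Area}_a(G)+\sum_{x\in V}K_a(x)=4\pi .$$
   Context: Planar graphs. "Planar graph" means a planar tessellation: $(V,E)$ is an undirected simple graph topologically embedded into the sphere or the plane, $F$ is the set of faces (connected components of the complement of the image), and (i) every face is homeomorphic to a disk whose boundary consists of finitely many edges; (ii) every edge is contained in exactly two different faces; (iii) if the closures of two faces intersect, the intersection is either a vertex or an edge. Every vertex $x$ and face $\sigma$ is assumed to satisfy $\deg(x)\ge 3$ and $\deg(\sigma)\ge 3$, where $\deg(x)$ is the number of neighbours of $x$ and $\deg(\sigma)$ is the number of edges incident to $\sigma$. We write $G=(V,E,F)$. Spherical polyhedral surfaces. Let $\mathbb S^2(1)$ be the unit sphere. A regular spherical polygon is a domain in $\mathbb S^2(1)$ that is an intersection of finitely many hemispheres, with all side lengths equal and all interior angles equal; only polygons with at least three sides are considered. For $n\ge 3$ and $0<a\le \frac{2\pi}{n}$, $\Delta_n(a)$ denotes the regular spherical $n$-gon of side length $a$ contained in a hemisphere (unique up to isometry). Its interior angle is $\beta_{n,a}=2\arcsin\frac{\cos(\pi/n)}{\cos(a/2)}$ and its area is $n\beta_{n,a}-(n-2)\pi$. For a finite planar graph $G=(V,E,F)$ and $0<a\le \inf_{\sigma\in F}\frac{2\pi}{\deg(\sigma)}$, $S_a(G)$ is the metric surface obtained by replacing each face $\sigma$ by $\Delta_{\deg(\sigma)}(a)$ and gluing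 along common edges. $\mathrm{Area}_a(G)$ is the area of $S_a(G)$, $\theta_a(x)$ is the total angle at the vertex $x$ measured in $S_a(G)$ (the sum of the interior angles at $x$ of the polygons incident to $x$), and $K_a(x)=2\pi-\theta_a(x)$ is the angle defect. *)

theory Defs
  imports "HOL-Analysis.Analysis"
begin

unbundle cross3_syntax

section \<open>Planar tessellations\<close>

text \<open>
  An undirected simple graph (two-element subsets of the vertex set as edges) together with a
  drawing: \<open>pos\<close> places the vertices and \<open>curve\<close> parametrises the edges on \<open>surface\<close>.
\<close>

record 'v embedded_graph =
  surface :: "(real^3) set"
  verts :: "'v set"
  edges :: "'v set set"
  pos :: "'v \<Rightarrow> real^3"
  curve :: "'v set \<Rightarrow> real \<Rightarrow> real^3"

definition edge_image :: "'v embedded_graph \<Rightarrow> 'v set \<Rightarrow> (real^3) set" where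
  "edge_image G e = path_image (curve G e)"

definition graph_image :: "'v embedded_graph \<Rightarrow> (real^3) set" where
  "graph_image G = pos G ` verts G \<union> (\<Union>e\<in>edges G. edge_image G e)"

definition faces :: "'v embedded_graph \<Rightarrow> (real^3) set set" where
  "faces G = components (surface G - graph_image G)"

definition vertex_degree :: "'v embedded_graph \<Rightarrow> 'v \<Rightarrow> nat" where
  "vertex_degree G x = card {y \<in> verts G. {x, y} \<in> edges G}"

definition face_degree :: "'v embedded_graph \<Rightarrow> (real^3) set \<Rightarrow> nat" where
  "face_degree G f = card {e \<in> edges G. edge_image G e \<subseteq> closure f}"

text \<open>
  For a finite graph, being topologically embedded amounts to: the vertices are distinct points,
  every edge is an arc joining its two end vertices and passing through no other vertex, and two
  distinct edges meet at most in common end vertices.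
\<close>

definition embedded :: "'v embedded_graph \<Rightarrow> bool" where
  "embedded G \<longleftrightarrow>
     (surface G = sphere 0 1 \<or> surface G = {p. p $ 3 = 0}) \<and>
     (\<forall>e\<in>edges G. e \<subseteq> verts G \<and> card e = 2) \<and>
     inj_on (pos G) (verts G) \<and> pos G ` verts G \<subseteq> surface G \<and>
     (\<forall>e\<in>edges G. arc (curve G e) \<and> edge_image G e \<subseteq> surface G \<and>
        {pathstart (curve G e), pathfinish (curve G e)} = pos G ` e \<and>
        edge_image G e \<inter> pos G ` verts G = pos G ` e) \<and>
     (\<forall>e\<in>edges G. \<forall>e'\<in>edges G. e \<noteq> e' \<longrightarrow>
        edge_image G e \<inter> edge_image G e' \<subseteq> pos G ` (e \<inter> e'))"

text \<open>
  Faces are open, being components of the complement.  That a face is a disk bounded by finitely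
  many edges is read as: its closure is a closed disk, whose interior is the face and whose
  boundary circle is a union of finitely many edges.  Asking only for the open face to be an
  (open) disk would admit faces that touch a vertex several times, such as the outer face
  of two tetrahedral graphs sharing one vertex; such a face does not have a polygon as closure.
\<close>

definition disk_face :: "'v embedded_graph \<Rightarrow> (real^3) set \<Rightarrow> bool" where
  "disk_face G f \<longleftrightarrow>
     (\<exists>h k B. homeomorphism (cball (0::real^2) 1) (closure f) h k \<and> h ` ball 0 1 = f \<and>
        finite B \<and> B \<subseteq> edges G \<and> h ` sphere 0 1 = (\<Union>e\<in>B. edge_image G e))"

definition finite_planar_graph :: "'v embedded_graph \<Rightarrow> bool" where
  "finite_planar_graph G \<longleftrightarrow>
     finite (verts G) \<and> embedded G \<and>
     (\<forall>f\<in>faces G. disk_face G f) \<and>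
     (\<forall>e\<in>edges G. card {f \<in> faces G. edge_image G e \<subseteq> closure f} = 2) \<and>
     (\<forall>f\<in>faces G. \<forall>g\<in>faces G. f \<noteq> g \<and> closure f \<inter> closure g \<noteq> {} \<longrightarrow>
        (\<exists>x\<in>verts G. closure f \<inter> closure g = {pos G x}) \<or>
        (\<exists>e\<in>edges G. closure f \<inter> closure g = edge_image G e)) \<and>
     (\<forall>x\<in>verts G. 3 \<le> vertex_degree G x) \<and>
     (\<forall>f\<in>faces G. 3 \<le> face_degree G f)"


section \<open>Regular spherical polygons\<close>

definition hemisphere :: "real^3 \<Rightarrow> (real^3) set" where
  "hemisphere u = {x \<in> sphere 0 1. 0 \<le> u \<bullet> x}"

definition spherical_dist :: "real^3 \<Rightarrow> real^3 \<Rightarrow> real" where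
  "spherical_dist x y = arccos (x \<bullet> y)"

text \<open>The initial direction at \<open>p\<close> of the geodesic from \<open>p\<close> to \<open>x\<close>, not normalised.\<close>

definition tangent_dir :: "real^3 \<Rightarrow> real^3 \<Rightarrow> real^3" where
  "tangent_dir p x = x - (x \<bullet> p) *\<^sub>R p"

definition spherical_angle :: "real^3 \<Rightarrow> real^3 \<Rightarrow> real^3 \<Rightarrow> real" where
  "spherical_angle x p y =
     arccos ((tangent_dir p x \<bullet> tangent_dir p y) / (norm (tangent_dir p x) * norm (tangent_dir p y)))"

text \<open>
  The area of a subset of the unit sphere is three times the volume of the cone over it from
  the origin.
\<close>

definition spherical_area :: "(real^3) set \<Rightarrow> real" where
  "spherical_area A = 3 * measure lebesgue {t *\<^sub>R x |t x. 0 \<le> t \<and> t \<le> 1 \<and> x \<in> A}"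

lemma spherical_area_sphere: "spherical_area (sphere 0 1) = 4 * pi"
proof -
  have "{t *\<^sub>R x |t x. 0 \<le> t \<and> t \<le> 1 \<and> x \<in> sphere 0 1} = cball (0::real^3) 1" (is "?L = ?R")
  proof (intro set_eqI iffI)
    fix y :: "real^3" assume y: "y \<in> ?R"
    show "y \<in> ?L"
    proof (cases "y = 0")
      case True
      have "norm (axis 1 1 :: real^3) = 1" by simp
      then show ?thesis using True
        by (intro CollectI exI[of _ 0] exI[of _ "axis 1 1 :: real^3"]) simp
    next
      case False
      then show ?thesis using y
        by (intro CollectI exI[of _ "norm y"] exI[of _ "y /\<^sub>R norm y"]) simp
    qed
  qed (auto simp: abs_if)
  moreover have "measure lebesgue (cball (0::real^3) 1) = 4 / 3 * pi"
    by (simp add: content_cball eval_unit_ball_vol)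
  ultimately show ?thesis by (simp add: spherical_area_def)
qed

text \<open>
  A regular spherical polygon is given by its cyclic sequence of corners, listed
  counterclockwise.  As corners and sides of a hemisphere seen as a polygon are not determined by
  the point set, they are part of the data.  The side from \<open>c k\<close> to \<open>c (Suc k)\<close> lies on the
  boundary of the hemisphere with pole along \<open>c k \<times> c (Suc k)\<close>.  Interior angles are at most
  \<open>pi\<close>, the polygon being an intersection of hemispheres, so \<open>spherical_angle\<close> gives them.
\<close>

definition polygon_region :: "nat \<Rightarrow> (nat \<Rightarrow> real^3) \<Rightarrow> (real^3) set" where
  "polygon_region n c = (\<Inter>k<n. hemisphere (c k \<times> c (Suc k)))"

definition regular_spherical_polygon :: "nat \<Rightarrow> real \<Rightarrow> (nat \<Rightarrow> real^3) \<Rightarrow> bool" where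
  "regular_spherical_polygon n a c \<longleftrightarrow>
     3 \<le> n \<and> (\<forall>k. c (k + n) = c k) \<and> inj_on c {..<n} \<and>
     range c \<subseteq> polygon_region n c \<and>
     (\<exists>p\<in>polygon_region n c. \<forall>k. 0 < (c k \<times> c (Suc k)) \<bullet> p) \<and>
     (\<forall>k. spherical_dist (c k) (c (Suc k)) = a) \<and>
     (\<forall>k. spherical_angle (c k) (c (Suc k)) (c (Suc (Suc k))) = spherical_angle (c 0) (c 1) (c 2)) \<and>
     (\<exists>u. norm u = 1 \<and> polygon_region n c \<subseteq> hemisphere u)"

text \<open>
  A representative of the regular \<open>n\<close>-gon of side length \<open>a\<close> contained in a hemisphere, which
  is unique up to isometry: it is centred at the north pole.  Bisecting the triangle formed by the
  centre and a side gives \<open>sin (a / 2) = sin r * sin (pi / n)\<close> for the circumradius \<open>r\<close>.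
\<close>

definition circumradius :: "nat \<Rightarrow> real \<Rightarrow> real" where
  "circumradius n a = arcsin (sin (a / 2) / sin (pi / real n))"

definition corner :: "nat \<Rightarrow> real \<Rightarrow> nat \<Rightarrow> real^3" where
  "corner n a k =
     (let r = circumradius n a; t = 2 * pi * real k / real n
      in vector [sin r * cos t, sin r * sin t, cos r])"

definition regular_polygon :: "nat \<Rightarrow> real \<Rightarrow> (real^3) set"  (\<open>\<Delta>\<close>) where
  "\<Delta> n a = polygon_region n (corner n a)"

definition interior_angle :: "nat \<Rightarrow> real \<Rightarrow> real" where
  "interior_angle n a = spherical_angle (corner n a 0) (corner n a 1) (corner n a 2)"


context
  fixes n :: nat and a :: real
  assumes n: "3 \<le> n" and a: "0 < a" "a \<le> 2 * pi / real n"
begin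

lemma n_pos: "0 < real n"
  using n by simp

lemma angle_bounds: "0 \<le> m \<Longrightarrow> 0 \<le> pi * m / n" "m \<le> n \<Longrightarrow> pi * m / n \<le> pi"
  "0 < m \<Longrightarrow> 0 < pi * m / n" "m < n \<Longrightarrow> pi * m / n < pi"
  using n_pos by (simp_all add: pos_divide_le_eq pos_divide_less_eq)

lemma half_angles:
  "0 < pi / n" "pi / n < pi / 2" "0 < a / 2" "a / 2 \<le> pi / n"
proof -
  show "pi / n < pi / 2"
    using n by (intro divide_strict_left_mono) auto
  show "0 < pi / n" "0 < a / 2" "a / 2 \<le> pi / n"
    using n_pos a by (auto simp: field_simps)
qed

lemma sin_pos: "0 < sin (pi / n)" "0 < sin (a / 2)"
  using half_angles by (intro sin_gt_zero; linarith)+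

lemma circumradius_props:
  "sin (circumradius n a) * sin (pi / n) = sin (a / 2)"
  "0 < sin (circumradius n a)" "0 \<le> cos (circumradius n a)"
proof -
  define q where "q = sin (a / 2) / sin (pi / n)"
  have "sin (a / 2) \<le> sin (pi / n)"
    using half_angles pi_gt_zero by (intro sin_monotone_2pi_le) linarith+
  then have q: "0 < q" "q \<le> 1"
    using sin_pos by (auto simp: q_def)
  then have r: "sin (circumradius n a) = q"
    by (simp add: circumradius_def q_def[symmetric])
  show "sin (circumradius n a) * sin (pi / n) = sin (a / 2)" "0 < sin (circumradius n a)"
    using sin_pos q unfolding r by (simp_all add: q_def)
  have "- (pi / 2) \<le> circumradius n a" "circumradius n a \<le> pi / 2"
    unfolding circumradius_def q_def[symmetric]
    using q arcsin_lbound[of q] arcsin_ubound[of q] by linarith+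
  then show "0 \<le> cos (circumradius n a)"
    by (rule cos_ge_zero)
qed

lemma inner_corner:
  "corner n a i \<bullet> corner n a j =
     1 - 2 * (sin (circumradius n a))\<^sup>2 * (sin (pi * (real i - real j) / n))\<^sup>2"
proof -
  define r s t where "r = circumradius n a" and "s = 2 * pi * i / n" and "t = 2 * pi * j / n"
  have "corner n a i \<bullet> corner n a j =
          (sin r)\<^sup>2 * (cos s * cos t + sin s * sin t) + (cos r)\<^sup>2"
    by (simp add: corner_def Let_def r_def s_def t_def inner_vec_def sum_3 algebra_simps power2_eq_square)
  also have "cos s * cos t + sin s * sin t = cos (2 * (pi * (real i - real j) / n))"
    unfolding cos_diff[symmetric]
    by (rule arg_cong[of _ _ cos]) (simp add: s_def t_def diff_divide_distrib algebra_simps)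
  also have "\<dots> = 1 - 2 * (sin (pi * (real i - real j) / n))\<^sup>2"
    by (rule cos_double_sin)
  also have "(cos r)\<^sup>2 = 1 - (sin r)\<^sup>2"
    by (rule cos_squared_eq)
  finally show ?thesis
    by (simp add: r_def algebra_simps)
qed

lemma inner_corner_Suc: "corner n a k \<bullet> corner n a (Suc k) = cos a"
proof -
  have "corner n a k \<bullet> corner n a (Suc k) = 1 - 2 * (sin (circumradius n a) * sin (pi / n))\<^sup>2"
    by (simp add: inner_corner power_mult_distrib)
  also have "\<dots> = cos (2 * (a / 2))"
    unfolding circumradius_props cos_double_sin ..
  finally show ?thesis by simp
qed

lemma inner_corner_Suc_Suc:
  "corner n a k \<bullet> corner n a (Suc (Suc k)) = 1 - 8 * (sin (a / 2))\<^sup>2 * (cos (pi / n))\<^sup>2"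
proof -
  have "pi * (real k - real (Suc (Suc k))) / n = - (2 * (pi / n))"
    by (simp add: field_simps)
  then have "corner n a k \<bullet> corner n a (Suc (Suc k)) =
      1 - 2 * (sin (circumradius n a))\<^sup>2 * (sin (2 * (pi / n)))\<^sup>2"
    unfolding inner_corner by (simp only: sin_minus power2_minus)
  also have "\<dots> = 1 - 8 * (sin (circumradius n a) * sin (pi / n))\<^sup>2 * (cos (pi / n))\<^sup>2"
    unfolding sin_double by (simp add: power2_eq_square)
  finally show ?thesis
    unfolding circumradius_props .
qed

lemma corner_in_sphere: "corner n a k \<in> sphere 0 1"
  using inner_corner[of k k] by (simp add: norm_eq_1)

lemma spherical_angle_corner:
  "spherical_angle (corner n a k) (corner n a (Suc k)) (corner n a (Suc (Suc k))) =
     2 * arcsin (cos (pi / n) / cos (a / 2))"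
proof -
  define x p y where "x = corner n a k" and "p = corner n a (Suc k)" and "y = corner n a (Suc (Suc k))"
  define s q where "s = (sin (a / 2))\<^sup>2" and "q = cos (pi / n) / cos (a / 2)"
  have nz: "x \<bullet> x = 1" "p \<bullet> p = 1" "y \<bullet> y = 1"
    using corner_in_sphere by (simp_all add: x_def p_def y_def norm_eq_1)
  have xp: "x \<bullet> p = cos a" "y \<bullet> p = cos a" "p \<bullet> x = cos a" "p \<bullet> y = cos a"
    using inner_corner_Suc by (simp_all add: x_def p_def y_def inner_commute)
  have ca: "cos a = 1 - 2 * s"
    using cos_double_sin[of "a / 2"] by (simp add: s_def)
  have c: "0 < cos (a / 2)" "0 \<le> cos (pi / n)" "cos (pi / n) \<le> cos (a / 2)"
    using half_angles
    by (intro cos_gt_zero_pi cos_ge_zero cos_monotone_0_pi_le; linarith)+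
  then have q: "0 \<le> q" "q \<le> 1"
    by (auto simp: q_def)
  have s: "0 < s" and s1: "1 - s = (cos (a / 2))\<^sup>2"
    using sin_pos by (auto simp: s_def cos_squared_eq)
  then have s1': "0 < 1 - s"
    using c by simp
  have len: "(norm (tangent_dir p x))\<^sup>2 = 4 * s * (1 - s)" "(norm (tangent_dir p y))\<^sup>2 = 4 * s * (1 - s)"
    unfolding power2_norm_eq_inner tangent_dir_def
    by (simp_all add: inner_diff_left inner_diff_right nz xp ca power2_eq_square algebra_simps)
  then have "norm (tangent_dir p x) = norm (tangent_dir p y)"
    by (metis norm_ge_zero power2_eq_iff_nonneg)
  then have "norm (tangent_dir p x) * norm (tangent_dir p y) = 4 * s * (1 - s)"
    using len by (simp add: power2_eq_square)
  moreover have "tangent_dir p x \<bullet> tangent_dir p y = 4 * s * (1 - s - 2 * (cos (pi / n))\<^sup>2)"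
  proof -
    have "x \<bullet> y = 1 - 8 * s * (cos (pi / n))\<^sup>2"
      unfolding x_def y_def s_def by (rule inner_corner_Suc_Suc)
    then show ?thesis
      by (simp add: tangent_dir_def inner_diff_left inner_diff_right nz xp ca power2_eq_square algebra_simps)
  qed
  ultimately have "(tangent_dir p x \<bullet> tangent_dir p y) / (norm (tangent_dir p x) * norm (tangent_dir p y))
      = (4 * s * (1 - s - 2 * (cos (pi / n))\<^sup>2)) / (4 * s * (1 - s))"
    by (simp only:)
  also have "\<dots> = 1 - 2 * ((cos (pi / n))\<^sup>2 / (1 - s))"
    using s s1' by (simp add: diff_divide_distrib)
  also have "\<dots> = 1 - 2 * (sin (arcsin q))\<^sup>2"
    using q by (simp add: s1 q_def power_divide)
  also have "\<dots> = cos (2 * arcsin q)"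
    by (rule cos_double_sin[symmetric])
  finally have "spherical_angle x p y = arccos (cos (2 * arcsin q))"
    by (simp add: spherical_angle_def)
  also have "\<dots> = 2 * arcsin q"
  proof (rule arccos_cos)
    show "0 \<le> 2 * arcsin q" using q arcsin_le_arcsin[of 0 q] by simp
    show "2 * arcsin q \<le> pi" using q arcsin_ubound[of q] by linarith
  qed
  finally show ?thesis
    by (simp add: x_def p_def y_def q_def)
qed

lemma interior_angle_eq: "interior_angle n a = 2 * arcsin (cos (pi / n) / cos (a / 2))"
  using spherical_angle_corner[of 0] by (simp add: interior_angle_def numeral_2_eq_2)

lemma pole_inner_corner:
  "(corner n a k \<times> corner n a (Suc k)) \<bullet> corner n a j =
     4 * cos (circumradius n a) * (sin (circumradius n a))\<^sup>2 * sin (pi / n) *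
       (sin (pi * (real j - real k) / n) * sin (pi * (real j - real k - 1) / n))"
proof -
  define r where "r = circumradius n a"
  define s t where "s = pi / n" and "t = pi * (real j - real k) / n"
  define x where "x = 2 * pi * k / n"
  have ang: "2 * pi * Suc k / n = x + 2 * s" "2 * pi * j / n = x + 2 * t"
    "pi * (real j - real k - 1) / n = t - s"
    using n_pos by (simp_all add: x_def s_def t_def field_simps)
  have "(corner n a k \<times> corner n a (Suc k)) \<bullet> corner n a j =
      cos r * (sin r)\<^sup>2 * ((sin (x + 2 * s) * cos x - cos (x + 2 * s) * sin x)
        + (sin (x + 2 * t) * cos (x + 2 * s) - cos (x + 2 * t) * sin (x + 2 * s))
        - (sin (x + 2 * t) * cos x - cos (x + 2 * t) * sin x))"
    unfolding corner_def Let_def r_def[symmetric] x_def[symmetric] ang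
    by (simp add: cross3_def inner_vec_def sum_3 power2_eq_square algebra_simps)
  also have "\<dots> = cos r * (sin r)\<^sup>2 * (sin (2 * s) + sin (2 * (t - s)) - sin (2 * t))"
    unfolding sin_diff[symmetric] by (simp add: algebra_simps)
  also have "sin (2 * s) + sin (2 * (t - s)) - sin (2 * t) = 4 * sin s * (sin t * sin (t - s))"
  proof -
    have "sin (2 * s) + sin (2 * (t - s)) = 2 * sin t * cos (2 * s - t)"
      using sin_add[of t "2 * s - t"] sin_diff[of t "2 * s - t"] by (simp add: algebra_simps)
    moreover have "cos (2 * s - t) - cos t = 2 * sin s * sin (t - s)"
      using cos_diff[of s "t - s"] cos_add[of s "t - s"]
      by (simp add: algebra_simps)
    ultimately show ?thesis
      unfolding sin_double[of t] by (simp add: algebra_simps)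
  qed
  finally show ?thesis
    by (simp add: ang r_def s_def t_def mult_ac)
qed

lemma pole_inner_corner_nonneg:
  assumes "k < n" and "j < n"
  shows "0 \<le> (corner n a k \<times> corner n a (Suc k)) \<bullet> corner n a j"
proof -
  have "0 \<le> sin (pi * (real j - real k) / n) * sin (pi * (real j - real k - 1) / n)"
  proof (cases "k < j")
    case True
    then show ?thesis
      using assms by (intro mult_nonneg_nonneg sin_ge_zero angle_bounds) auto
  next
    case False
    then have "0 \<le> sin (pi * (real k - real j) / n)" "0 \<le> sin (pi * (real k - real j + 1) / n)"
      using assms by (auto intro!: sin_ge_zero angle_bounds)
    moreover have "pi * (real j - real k) / n = - (pi * (real k - real j) / n)"
      "pi * (real j - real k - 1) / n = - (pi * (real k - real j + 1) / n)"
      by (simp_all add: diff_divide_distrib add_divide_distrib algebra_simps)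
    ultimately show ?thesis
      by (simp only: sin_minus minus_mult_minus mult_nonneg_nonneg)
  qed
  then show ?thesis
    unfolding pole_inner_corner using circumradius_props sin_pos
    by (intro mult_nonneg_nonneg[OF mult_nonneg_nonneg]) auto
qed

lemma corner_periodic: "corner n a (k + n) = corner n a k"
proof -
  have "2 * pi * real (k + n) / n = 2 * pi * k / n + 2 * pi"
    using n by (simp add: field_simps)
  then show ?thesis
    by (simp add: corner_def Let_def)
qed

lemma inj_on_corner: "inj_on (corner n a) {..<n}"
proof -
  have neq: "corner n a i \<noteq> corner n a j" if "i < j" "j < n" for i j
  proof
    assume "corner n a i = corner n a j"
    then have "corner n a j \<bullet> corner n a i = 1"
      using corner_in_sphere[of j] by (simp add: norm_eq_1)
    then have "sin (pi * (real j - real i) / n) = 0"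
      using circumradius_props unfolding inner_corner by simp
    moreover have "0 < pi * (real j - real i) / n" "pi * (real j - real i) / n < pi"
      using that by (auto intro!: angle_bounds)
    then have "0 < sin (pi * (real j - real i) / n)"
      by (rule sin_gt_zero)
    ultimately show False by simp
  qed
  then show ?thesis
    by (auto simp: inj_on_def) (metis linorder_neqE_nat)
qed

lemma pole_inner_north: "0 < (corner n a k \<times> corner n a (Suc k)) \<bullet> axis 3 1"
proof -
  define s where "s = 2 * pi / n"
  define x where "x = 2 * pi * k / n"
  have ang: "2 * pi * Suc k / n = x + s"
    using n by (simp add: x_def s_def field_simps)
  have "(corner n a k \<times> corner n a (Suc k)) \<bullet> axis 3 1 =
      (sin (circumradius n a))\<^sup>2 * (sin (x + s) * cos x - cos (x + s) * sin x)"
    unfolding corner_def Let_def x_def[symmetric] ang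
    by (simp add: cross3_def inner_axis power2_eq_square algebra_simps)
  also have "sin (x + s) * cos x - cos (x + s) * sin x = sin s"
    unfolding sin_diff[symmetric] by simp
  finally have "(corner n a k \<times> corner n a (Suc k)) \<bullet> axis 3 1 = (sin (circumradius n a))\<^sup>2 * sin s" .
  moreover have "0 < sin s"
    using angle_bounds[of 2] n by (intro sin_gt_zero) (simp_all add: s_def mult.commute[of 2])
  ultimately show ?thesis
    using circumradius_props by simp
qed

lemma regular_corner: "regular_spherical_polygon n a (corner n a)"
proof -
  let ?c = "corner n a"
  have corner_mod: "?c k = ?c (k mod n)" for k
  proof -
    have "?c (m + i * n) = ?c m" for m i
      by (induction i) (simp_all add: corner_periodic add.assoc[symmetric] add.commute[of n])
    from this[of "k mod n" "k div n"] show ?thesis by simp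
  qed
  have "?c j \<in> polygon_region n ?c" for j
    using n corner_in_sphere[of j] pole_inner_corner_nonneg[of _ "j mod n"]
    by (auto simp: polygon_region_def hemisphere_def corner_mod[of j])
  moreover have "axis 3 1 \<in> polygon_region n ?c"
    using pole_inner_north by (auto simp: polygon_region_def hemisphere_def intro: less_imp_le)
  moreover have "spherical_dist (?c k) (?c (Suc k)) = a" for k
    unfolding spherical_dist_def inner_corner_Suc
    using half_angles pi_gt_zero by (intro arccos_cos) linarith+
  moreover have "\<exists>u. norm u = 1 \<and> polygon_region n ?c \<subseteq> hemisphere u"
  proof (intro exI conjI)
    let ?w = "?c 0 \<times> ?c (Suc 0)"
    have w: "0 < norm ?w"
      using pole_inner_north[of 0] by auto
    then show "norm (?w /\<^sub>R norm ?w) = 1"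
      by simp
    show "polygon_region n ?c \<subseteq> hemisphere (?w /\<^sub>R norm ?w)"
    proof
      fix x assume "x \<in> polygon_region n ?c"
      then have "x \<in> hemisphere ?w"
        using n unfolding polygon_region_def by (auto dest!: bspec[of _ _ 0])
      then show "x \<in> hemisphere (?w /\<^sub>R norm ?w)"
        using w by (auto simp: hemisphere_def)
    qed
  qed
  ultimately show ?thesis
    unfolding regular_spherical_polygon_def
    using n corner_periodic inj_on_corner pole_inner_north spherical_angle_corner
      spherical_angle_corner[of 0]
    by (auto simp: numeral_2_eq_2)
qed

end


section \<open>The spherical polyhedral surface of a planar graph\<close>

text \<open>
  The polygons overlap only in their sides in the glued surface, so its area is the sum of their areas.
\<close>

definition surface_area :: "real \<Rightarrow> 'v embedded_graph \<Rightarrow> real" where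
  "surface_area a G = (\<Sum>f\<in>faces G. spherical_area (\<Delta> (face_degree G f) a))"

definition total_angle :: "real \<Rightarrow> 'v embedded_graph \<Rightarrow> 'v \<Rightarrow> real" where
  "total_angle a G x =
     (\<Sum>f\<in>{f \<in> faces G. pos G x \<in> closure f}. interior_angle (face_degree G f) a)"

definition angle_defect :: "real \<Rightarrow> 'v embedded_graph \<Rightarrow> 'v \<Rightarrow> real" where
  "angle_defect a G x = 2 * pi - total_angle a G x"

end

theory Submission
  imports Defs
begin

text \<open>
  The proof separates geometry from topology. A regular spherical \<open>n\<close>-gon of side length \<open>a\<close> has
  area \<open>n * \<beta> - (n - 2) * pi\<close>, where \<open>\<beta>\<close> is its interior angle (lemma \<open>area_regular_polygon\<close>). Add
  this over all faces, which have \<open>n\<^sub>f\<close> sides and angle \<open>\<beta>\<^sub>f\<close>: the terms \<open>n\<^sub>f * \<beta>\<^sub>f\<close> add up to the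
  sum of all angles at all vertices, because a face has as many vertices as edges
  (\<open>card_face_verts\<close>); the terms \<open>n\<^sub>f\<close> add up to \<open>2 * E\<close>, because an edge lies on two faces
  (\<open>sum_face_degree\<close>). The angle defects add up to \<open>2 * pi * V\<close> minus the same sum of angles, so
  the angles cancel, the side length \<open>a\<close> disappears, and \<open>2 * pi * (V - E + F)\<close> remains. It is
  \<open>4 * pi\<close> by Euler's formula (\<open>euler\<close>).

  The area of the polygon is obtained by Girard's argument for the volume of the cone over it.
  Rotations make the volume of a wedge between two half-spaces additive in its angle, hence
  proportional to it; inclusion and exclusion with the antipodal map give the volume of a cone
  with three sides; and a regular polygon consists of \<open>n\<close> triangles around its centre.

  Euler's formula is obtained without spanning trees from a duality between connectedness of the
  graph and of its dual. Insert the edges one by one into a set \<open>S\<close>, and remove them at the same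
  time from the dual graph on the faces, whose edges are those outside \<open>S\<close>. If each new edge
  either joins two components of \<open>S\<close> or splits a component of the dual, but not both, then
  \<open>V - E + F = 2\<close> follows by counting (\<open>euler_from_duality\<close>), as the graph and its dual are connected
  (\<open>primal_connected\<close> and \<open>dual_connected\<close>). That the two do not happen at once is a parity
  argument: a cut of the graph contains an even number of edges of each face
  (\<open>dual_reach_if_not_reach\<close>). That one of them happens, that is, that an edge closing a cycle
  separates its two faces, is the Jordan curve theorem (\<open>not_dual_reach_if_reach\<close>).
\<close>

section \<open>The volume of a cone bounded by two or three planes\<close>

text \<open>
  Cauchy's functional equation on a bounded interval. After subtraction of the linear function
  that agrees with \<open>f\<close> at \<open>y\<close>, the difference \<open>g\<close> vanishes at \<open>y / m\<close>, so it takes the same values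
  on \<open>[0, y / m)\<close> as on the whole interval; there they are at most \<open>f y / m\<close> in absolute value, as
  \<open>f\<close> is monotone.
\<close>

lemma additive_nonneg_imp_linear:
  fixes f :: "real \<Rightarrow> real"
  assumes add: "\<And>x y. 0 \<le> x \<Longrightarrow> 0 \<le> y \<Longrightarrow> x + y < b \<Longrightarrow> f (x + y) = f x + f y"
    and nonneg: "\<And>x. 0 \<le> x \<Longrightarrow> x < b \<Longrightarrow> 0 \<le> f x"
    and y: "0 < y" "y < b" and x: "0 \<le> x" "x < b"
  shows "f x = x / y * f y"
proof -
  define c g where "c = f y / y" and "g = (\<lambda>x. f x - x * c)"
  have c: "0 \<le> c" using nonneg y by (simp add: c_def)
  have g_add: "g (s + t) = g s + g t" if "0 \<le> s" "0 \<le> t" "s + t < b" for s t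
    using add[OF that] by (simp add: g_def algebra_simps)
  have g_mult: "g (real k * z) = real k * g z" if "0 \<le> z" "real k * z < b" for k z
    using that
  proof (induction k)
    case 0
    then show ?case using g_add[of 0 0] by simp
  next
    case (Suc k)
    have "g (real k * z + z) = g (real k * z) + g z"
      using Suc.prems by (intro g_add) (auto simp: algebra_simps)
    moreover have "real k * z < b"
      using Suc.prems by (simp add: algebra_simps)
    ultimately show ?case using Suc by (simp add: algebra_simps)
  qed
  have bound: "\<bar>g x\<bar> \<le> c * y / real m" if m: "0 < m" for m :: nat
  proof -
    define d k where "d = y / real m" and "k = nat \<lfloor>x / d\<rfloor>"
    have d: "0 < d" and md: "real m * d = y"
      using y m by (auto simp: d_def)
    have db: "d < b"
      using y m d md by (smt (verit) mult_le_cancel_right1 of_nat_0_less_iff One_nat_def Suc_leI of_nat_1 of_nat_le_iff)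
    have gd: "g d = 0"
      using g_mult[of d m] d m y by (simp add: md g_def c_def)
    have kx: "real k = of_int \<lfloor>x / d\<rfloor>" using x d by (simp add: k_def)
    have k: "real k * d \<le> x" "x < real k * d + d"
    proof -
      have "real k \<le> x / d" "x / d < real k + 1" unfolding kx by linarith+
      then show "real k * d \<le> x" "x < real k * d + d"
        using d by (auto simp: field_simps)
    qed
    define s where "s = x - real k * d"
    have s: "0 \<le> s" "s < d" using k by (auto simp: s_def)
    have "g x = g (real k * d) + g s"
      using g_add[of "real k * d" s] s d x by (auto simp: s_def)
    also have "g (real k * d) = 0"
      using g_mult[of d k] gd d k x by simp
    finally have gx: "g x = f s - s * c" by (simp add: g_def)
    have "f d = f s + f (d - s)" using add[of s "d - s"] s db by simp
    moreover have "0 \<le> f (d - s)" "0 \<le> f s"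
      using nonneg s db by auto
    moreover have "f d = d * c" using gd by (simp add: g_def)
    moreover have "0 \<le> s * c" "s * c \<le> d * c" using s c by (auto intro: mult_right_mono)
    ultimately have "\<bar>g x\<bar> \<le> d * c" unfolding gx by linarith
    then show ?thesis by (simp add: d_def mult.commute)
  qed
  have "\<bar>g x\<bar> \<le> 0"
  proof (rule LIMSEQ_le_const)
    show "(\<lambda>m. c * y / real m) \<longlonglongrightarrow> 0" by (rule lim_const_over_n)
    show "\<exists>N. \<forall>m\<ge>N. \<bar>g x\<bar> \<le> c * y / real m"
      using bound by (intro exI[of _ 1]) auto
  qed
  then show ?thesis by (simp add: g_def c_def)
qed

text \<open>
  One of the two half-spaces is closed and the other open, so that adjacent wedges are disjoint.
\<close>

definition wedge :: "'a::euclidean_space \<Rightarrow> 'a \<Rightarrow> 'a set" where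
  "wedge u v = {x \<in> cball 0 1. 0 \<le> u \<bullet> x \<and> v \<bullet> x < 0}"

lemma lmeasurable_in_cball:
  fixes S :: "'a::euclidean_space set"
  assumes "S \<in> sets borel" "S \<subseteq> cball 0 1"
  shows "S \<in> lmeasurable"
  using assms by (intro bounded_set_imp_lmeasurable) (auto intro: bounded_subset[OF bounded_cball])

lemma half_ball_lmeasurable:
  "{x \<in> cball 0 1. 0 \<le> u \<bullet> x} \<in> lmeasurable" for u :: "'a::euclidean_space"
proof (rule lmeasurable_in_cball)
  show "{x \<in> cball 0 1. 0 \<le> u \<bullet> x} \<in> sets borel"
    by measurable
qed auto

lemma wedge_lmeasurable: "wedge u v \<in> lmeasurable"
proof (rule lmeasurable_in_cball)
  show "wedge u v \<in> sets borel"
    unfolding wedge_def by measurable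
qed (auto simp: wedge_def)

lemma measure_lebesgue_disjoint_Un:
  assumes "A \<in> lmeasurable" "B \<in> lmeasurable" "A \<inter> B = {}"
  shows "measure lebesgue (A \<union> B) = measure lebesgue A + measure lebesgue B"
  using assms by (simp only: measure_Un3 measure_empty)

text \<open>
  For orthonormal \<open>e\<close> and \<open>w\<close> this is the rotation by \<open>t\<close> in the plane that they span, which fixes
  the orthogonal complement of that plane.
\<close>

definition plane_rotation :: "'a::real_inner \<Rightarrow> 'a \<Rightarrow> real \<Rightarrow> 'a \<Rightarrow> 'a" where
  "plane_rotation e w t x = x + ((cos t - 1) * (e \<bullet> x) - sin t * (w \<bullet> x)) *\<^sub>R e
     + (sin t * (e \<bullet> x) + (cos t - 1) * (w \<bullet> x)) *\<^sub>R w"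

definition plane_direction :: "'a::real_inner \<Rightarrow> 'a \<Rightarrow> real \<Rightarrow> 'a" where
  "plane_direction e w t = cos t *\<^sub>R e + sin t *\<^sub>R w"

context
  fixes e w :: "real^'n::{finite,wellorder}"
  assumes orthonormal: "norm e = 1" "norm w = 1" "e \<bullet> w = 0"
begin

lemma inner_ew: "e \<bullet> e = 1" "w \<bullet> w = 1" "e \<bullet> w = 0" "w \<bullet> e = 0"
  using orthonormal by (auto simp: norm_eq_1 inner_commute)

lemma inner_plane_rotation:
  "e \<bullet> plane_rotation e w t x = cos t * (e \<bullet> x) - sin t * (w \<bullet> x)"
  "w \<bullet> plane_rotation e w t x = sin t * (e \<bullet> x) + cos t * (w \<bullet> x)"
  by (simp_all add: plane_rotation_def inner_add_right inner_ew algebra_simps)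

lemma orthogonal_plane_rotation: "orthogonal_transformation (plane_rotation e w t)"
proof -
  have lin: "linear (plane_rotation e w t)"
    by (rule linearI) (simp_all add: plane_rotation_def algebra_simps)
  have "plane_rotation e w t x \<bullet> plane_rotation e w t y = x \<bullet> y" for x y
  proof -
    define p q p' q' where "p = e \<bullet> x" and "q = w \<bullet> x" and "p' = e \<bullet> y" and "q' = w \<bullet> y"
    have *: "x \<bullet> e = p" "x \<bullet> w = q" "e \<bullet> y = p'" "w \<bullet> y = q'" "e \<bullet> x = p" "w \<bullet> x = q"
      by (simp_all add: p_def q_def p'_def q'_def inner_commute)
    have "plane_rotation e w t x \<bullet> plane_rotation e w t y = x \<bullet> y - p * p' - q * q'
       + (cos t * p - sin t * q) * (cos t * p' - sin t * q')
       + (sin t * p + cos t * q) * (sin t * p' + cos t * q')"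
      by (simp add: plane_rotation_def inner_add_left inner_add_right inner_ew * algebra_simps)
    also have "\<dots> = x \<bullet> y + (p * p' + q * q') * ((sin t)\<^sup>2 + (cos t)\<^sup>2 - 1)"
      by (simp only: power2_eq_square algebra_simps)
    finally show ?thesis by simp
  qed
  with lin show ?thesis by (simp add: orthogonal_transformation_def)
qed

lemma plane_direction_rotation:
  "plane_direction e w (s + t) \<bullet> plane_rotation e w t x = plane_direction e w s \<bullet> x"
proof -
  have "plane_direction e w (s + t) \<bullet> plane_rotation e w t x =
    (cos s * (e \<bullet> x) + sin s * (w \<bullet> x)) * ((sin t)\<^sup>2 + (cos t)\<^sup>2)"
    unfolding plane_direction_def inner_add_left inner_scaleR_left inner_plane_rotation
      cos_add sin_add power2_eq_square by (simp only: algebra_simps)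
  then show ?thesis by (simp add: plane_direction_def inner_add_left)
qed

lemma measure_wedge_rotate:
  "measure lebesgue (wedge (plane_direction e w (s + t)) (plane_direction e w (s' + t))) =
   measure lebesgue (wedge (plane_direction e w s) (plane_direction e w s'))"
proof -
  let ?R = "plane_rotation e w t"
  have n: "norm (?R x) = norm x" for x
    using orthogonal_plane_rotation by (rule orthogonal_transformation_norm)
  have "?R ` wedge (plane_direction e w s) (plane_direction e w s') =
     wedge (plane_direction e w (s + t)) (plane_direction e w (s' + t))" (is "?R ` ?A = ?B")
  proof
    show "?R ` ?A \<subseteq> ?B"
      by (auto simp: wedge_def plane_direction_rotation n)
    show "?B \<subseteq> ?R ` ?A"
    proof
      fix y assume y: "y \<in> ?B"
      obtain x where "y = ?R x"
        using orthogonal_transformation_surj[OF orthogonal_plane_rotation[of t]] by (metis surjD)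
      with y show "y \<in> ?R ` ?A"
        by (auto simp: wedge_def plane_direction_rotation n)
    qed
  qed
  then show ?thesis
    using measure_orthogonal_image[OF orthogonal_plane_rotation wedge_lmeasurable] by metis
qed

text \<open>
  The middle normal is a combination of the outer ones with nonnegative coefficients after
  multiplication by \<open>sin (s + t)\<close>. This is where the total angle has to be less than \<open>pi\<close>.
\<close>

lemma wedge_split:
  assumes "0 \<le> s" "0 \<le> t" "s + t < pi"
  shows "wedge (plane_direction e w 0) (plane_direction e w (s + t)) =
    wedge (plane_direction e w 0) (plane_direction e w s) \<union>
    wedge (plane_direction e w s) (plane_direction e w (s + t))"
proof (cases "s = 0 \<or> t = 0")
  case True
  then show ?thesis by (auto simp: wedge_def)
next
  case False
  then have pos: "0 < sin s" "0 < sin t" "0 < sin (s + t)"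
    using assms by (auto intro!: sin_gt_zero)
  have eq: "sin (s + t) * (plane_direction e w s \<bullet> x) =
      sin t * (plane_direction e w 0 \<bullet> x) + sin s * (plane_direction e w (s + t) \<bullet> x)" for x
  proof -
    have "cos s * sin (s + t) = sin t + cos (s + t) * sin s"
    proof -
      have "sin t = sin ((s + t) - s)" by simp
      then show ?thesis unfolding sin_diff by (simp add: algebra_simps)
    qed
    then have "(sin (s + t) * cos s) * (e \<bullet> x) = (sin t + cos (s + t) * sin s) * (e \<bullet> x)"
      by (simp add: mult.commute)
    then show ?thesis
      by (simp add: plane_direction_def inner_add_left algebra_simps)
  qed
  have 1: "plane_direction e w (s + t) \<bullet> x < 0"
    if "0 \<le> plane_direction e w 0 \<bullet> x" "plane_direction e w s \<bullet> x < 0" for x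
  proof (rule ccontr)
    assume "\<not> ?thesis"
    then have "0 \<le> sin (s + t) * (plane_direction e w s \<bullet> x)"
      unfolding eq using that pos by (intro add_nonneg_nonneg mult_nonneg_nonneg) auto
    then show False using that pos by (simp add: zero_le_mult_iff)
  qed
  have 2: "0 \<le> plane_direction e w 0 \<bullet> x"
    if "0 \<le> plane_direction e w s \<bullet> x" "plane_direction e w (s + t) \<bullet> x < 0" for x
  proof (rule ccontr)
    assume "\<not> ?thesis"
    then have "sin (s + t) * (plane_direction e w s \<bullet> x) < 0"
      unfolding eq using that pos by (intro add_neg_neg mult_pos_neg) auto
    then show False using that pos by (simp add: mult_less_0_iff)
  qed
  show ?thesis
    using 1 2 by (auto simp: wedge_def not_less)
qed

end

text \<open>
  The antipodal map exchanges the two halves.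
\<close>

lemma measure_half_ball:
  fixes u :: "real^'n::{finite,wellorder}"
  assumes "u \<noteq> 0"
  shows "measure lebesgue {x \<in> cball 0 1. 0 \<le> u \<bullet> x} = measure lebesgue (cball (0::real^'n::_) 1) / 2"
proof -
  let ?P = "{x \<in> cball 0 1. 0 \<le> u \<bullet> x}" and ?N = "{x \<in> cball 0 1. u \<bullet> x \<le> 0}"
  have m: "?P \<in> lmeasurable" "?N \<in> lmeasurable"
    using half_ball_lmeasurable[of u] half_ball_lmeasurable[of "- u"] by auto
  have "?N = (\<lambda>x. - x) ` ?P" 
  proof (intro set_eqI iffI)
    fix x assume "x \<in> ?N"
    then show "x \<in> (\<lambda>x. - x) ` ?P" by (intro image_eqI[of _ _ "- x"]) auto
  qed auto
  then have "measure lebesgue ?N = measure lebesgue ?P"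
    using measure_orthogonal_image[of "\<lambda>x. - x" ?P] m(1) by (simp add: orthogonal_transformation_def linear_iff)
  moreover have "measure lebesgue (?P \<union> ?N) = measure lebesgue ?P + measure lebesgue ?N"
    using m
  proof (rule measure_Un3[THEN trans])
    have "negligible (?P \<inter> ?N)"
      by (rule negligible_subset[OF negligible_hyperplane[of u 0]]) (use assms in auto)
    then show "measure lebesgue ?P + measure lebesgue ?N - measure lebesgue (?P \<inter> ?N) =
        measure lebesgue ?P + measure lebesgue ?N"
      using negligible_imp_measure0[of "?P \<inter> ?N"] by linarith
  qed
  moreover have "?P \<union> ?N = cball 0 1" by auto
  ultimately show ?thesis by simp
qed

text \<open>
  The volume is an additive function of the angle between \<open>u\<close> and \<open>v\<close>, and a quarter of the ball
  for a right angle.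
\<close>

lemma measure_wedge:
  fixes u v :: "real^'n::{finite,wellorder}"
  assumes u: "norm u = 1" and v: "norm v = 1"
  shows "measure lebesgue (wedge u v) = arccos (u \<bullet> v) / (2 * pi) * measure lebesgue (cball (0::real^'n::_) 1)"
proof -
  let ?T = "measure lebesgue (cball (0::real^'n::_) 1)"
  define t where "t = arccos (u \<bullet> v)"
  have uv: "\<bar>u \<bullet> v\<bar> \<le> 1"
    using Cauchy_Schwarz_ineq2[of u v] u v by simp
  have ct: "cos t = u \<bullet> v" and t: "0 \<le> t" "t \<le> pi"
    using uv by (auto simp: t_def cos_arccos_abs arccos_lbound arccos_ubound abs_le_iff)
  have iu: "u \<bullet> u = 1" "v \<bullet> v = 1" using u v by (auto simp: norm_eq_1)
  consider "t = 0" | "t = pi" | "0 < t" "t < pi" using t by linarith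
  then show ?thesis
  proof cases
    case 1
    then have "u \<bullet> v = 1" using ct by simp
    then have "norm (u - v) = 0"
      by (simp add: norm_eq_sqrt_inner inner_diff_left inner_diff_right iu inner_commute)
    then have "wedge u v = {}" by (auto simp: wedge_def)
    with 1 show ?thesis by (simp add: t_def)
  next
    case 2
    then have "u \<bullet> v = -1" using ct by simp
    then have "norm (u + v) = 0"
      by (simp add: norm_eq_sqrt_inner inner_add_left inner_add_right iu inner_commute)
    then have "v = - u" by (simp add: eq_neg_iff_add_eq_0 add.commute)
    then have w: "wedge u v = {x \<in> cball 0 1. 0 < u \<bullet> x}" by (auto simp: wedge_def)
    have "measure lebesgue (wedge u v) = measure lebesgue {x \<in> cball 0 1. 0 \<le> u \<bullet> x}"
    proof (rule measure_negligible_symdiff)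
      show "{x \<in> cball 0 1. 0 \<le> u \<bullet> x} \<in> lmeasurable"
        by (rule half_ball_lmeasurable)
      show "negligible ({x \<in> cball 0 1. 0 \<le> u \<bullet> x} - wedge u v \<union> (wedge u v - {x \<in> cball 0 1. 0 \<le> u \<bullet> x}))"
        by (rule negligible_subset[OF negligible_hyperplane[of u 0]]) (use u in \<open>auto simp: w\<close>)
    qed
    also have "\<dots> = ?T / 2" by (rule measure_half_ball) (use u in auto)
    finally show ?thesis using 2 by (simp add: t_def)
  next
    case 3
    then have st: "0 < sin t" by (intro sin_gt_zero)
    define w where "w = (v - cos t *\<^sub>R u) /\<^sub>R sin t"
    have uw: "u \<bullet> w = 0"
      by (simp add: w_def inner_diff_right iu ct)
    have "(v - cos t *\<^sub>R u) \<bullet> (v - cos t *\<^sub>R u) = 1 - (cos t)\<^sup>2"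
      by (simp add: inner_diff_left inner_diff_right iu ct inner_commute power2_eq_square)
    then have "(v - cos t *\<^sub>R u) \<bullet> (v - cos t *\<^sub>R u) = (sin t)\<^sup>2"
      by (simp add: sin_squared_eq)
    then have "w \<bullet> w = 1"
      using st by (simp add: w_def power2_eq_square divide_simps)
    then have w: "norm w = 1" by (simp add: norm_eq_1)
    note on = u w uw
    have vw: "v = plane_direction u w t"
      using st by (simp add: plane_direction_def w_def)
    define f where "f = (\<lambda>s. measure lebesgue (wedge (plane_direction u w 0) (plane_direction u w s)))"
    have add: "f (x + y) = f x + f y" if "0 \<le> x" "0 \<le> y" "x + y < pi" for x y
    proof -
      have "f (x + y) = measure lebesgue (wedge (plane_direction u w 0) (plane_direction u w x) \<union>
          wedge (plane_direction u w x) (plane_direction u w (x + y)))"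
        unfolding f_def wedge_split[OF on that] ..
      also have "\<dots> = f x + measure lebesgue (wedge (plane_direction u w x) (plane_direction u w (x + y)))"
        unfolding f_def by (intro measure_lebesgue_disjoint_Un wedge_lmeasurable) (auto simp: wedge_def)
      also have "\<dots> = f x + f y"
        using measure_wedge_rotate[OF on, of 0 x y] by (simp add: f_def add.commute)
      finally show ?thesis .
    qed
    have "f (pi / 2) = ?T / 4"
    proof -
      have d: "plane_direction u w 0 = u" "plane_direction u w (pi / 2) =
          w" "plane_direction u w (pi / 2 + pi / 2) = - u"
        by (simp_all add: plane_direction_def)
      have "f (pi / 2) = measure lebesgue (wedge u w)" by (simp only: f_def d)
      moreover have "f (pi / 2) = measure lebesgue (wedge w (- u))"
        using measure_wedge_rotate[OF on, of 0 "pi / 2" "pi / 2"] by (simp only: f_def d add_0)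
      moreover have "measure lebesgue (wedge u w \<union> wedge w (- u)) =
          measure lebesgue (wedge u w) + measure lebesgue (wedge w (- u))"
        by (intro measure_lebesgue_disjoint_Un wedge_lmeasurable) (auto simp: wedge_def)
      moreover have "measure lebesgue (wedge u w \<union> wedge w (- u)) = measure lebesgue {x \<in> cball 0 1. 0 \<le> u \<bullet> x}"
      proof (rule measure_negligible_symdiff)
        show "{x \<in> cball 0 1. 0 \<le> u \<bullet> x} \<in> lmeasurable"
          by (rule half_ball_lmeasurable)
        show "negligible ({x \<in> cball 0 1. 0 \<le> u \<bullet> x} - (wedge u w \<union> wedge w (- u)) \<union> (wedge u w \<union>
            wedge w (- u) - {x \<in> cball 0 1. 0 \<le> u \<bullet> x}))"
          by (rule negligible_subset[OF negligible_hyperplane[of u 0]]) (use u in \<open>auto simp: wedge_def\<close>)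
      qed
      moreover have "\<dots> = ?T / 2" by (rule measure_half_ball) (use u in auto)
      ultimately show ?thesis by simp
    qed
    moreover have "f t = t / (pi / 2) * f (pi / 2)"
      by (rule additive_nonneg_imp_linear[where b = pi]) (use 3 add in \<open>auto simp: f_def\<close>)
    ultimately have "f t = t / (pi / 2) * (?T / 4)" by metis
    then have "f t = t / (2 * pi) * ?T" by (simp only: divide_inverse inverse_mult_distrib inverse_inverse_eq mult_ac) simp
    moreover have "f t = measure lebesgue (wedge u v)"
      by (simp add: f_def vw) (simp add: plane_direction_def)
    ultimately show ?thesis by (simp add: t_def)
  qed
qed

text \<open>
  Girard's theorem. The half-spaces cut the ball into eight cells, and the wedges of the three
  pairs contain together each of the cells with exactly two nonnegative signs, or an antipode of
  it, twice. These cells and the cell in question make up half of the ball. The dihedral angle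
  between two of the planes is \<open>pi\<close> minus the angle between their normals.
\<close>

lemma measure_trihedral_cone:
  fixes u v w :: "real^'n::{finite,wellorder}"
  assumes unit: "norm u = 1" "norm v = 1" "norm w = 1"
  shows "measure lebesgue {x \<in> cball 0 1. 0 \<le> u \<bullet> x \<and> 0 \<le> v \<bullet> x \<and> 0 \<le> w \<bullet> x} =
    measure lebesgue (cball (0::real^'n::_) 1) / (4 * pi) *
      (2 * pi - arccos (u \<bullet> v) - arccos (u \<bullet> w) - arccos (v \<bullet> w))"
proof -
  let ?m = "measure lebesgue" and ?T = "measure lebesgue (cball (0::real^'n::_) 1)"
  define H where "H = (\<lambda>a b c. {x \<in> cball 0 1. (0 \<le> u \<bullet> x \<longleftrightarrow> a) \<and> (0 \<le> v \<bullet> x \<longleftrightarrow> b) \<and> (0 \<le> w \<bullet> x \<longleftrightarrow> c)})"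
  have m: "H a b c \<in> lmeasurable" for a b c
  proof (rule lmeasurable_in_cball)
    show "H a b c \<in> sets borel" unfolding H_def by measurable
  qed (auto simp: H_def)
  have u0: "u \<noteq> 0" using unit by auto
  have uv: "wedge u v = H True False True \<union> H True False False"
    and uw: "wedge u w = H True True False \<union> H True False False"
    and vw: "wedge v w = H True True False \<union> H False True False"
    by (auto simp: wedge_def H_def not_le)
  have half: "{x \<in> cball 0 1. 0 \<le> u \<bullet> x} = (H True True True \<union> H True True False) \<union> (H True False True \<union>
      H True False False)"
    by (auto simp: H_def)
  have d: "H a b c \<inter> H a' b' c' = {}" if "(a,b,c) \<noteq> (a',b',c')" for a b c a' b' c'
    using that by (auto simp: H_def)
  have w1: "?m (wedge u v) = ?m (H True False True) + ?m (H True False False)"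
    unfolding uv by (rule measure_lebesgue_disjoint_Un[OF m m d]) simp
  have w2: "?m (wedge u w) = ?m (H True True False) + ?m (H True False False)"
    unfolding uw by (rule measure_lebesgue_disjoint_Un[OF m m d]) simp
  have w3: "?m (wedge v w) = ?m (H True True False) + ?m (H False True False)"
    unfolding vw by (rule measure_lebesgue_disjoint_Un[OF m m d]) simp
  have "?m {x \<in> cball 0 1. 0 \<le> u \<bullet> x} = ?m (H True True True \<union> H True True False) +
      ?m (H True False True \<union> H True False False)"
    unfolding half by (intro measure_lebesgue_disjoint_Un fmeasurable.Un m) (auto simp: H_def)
  also have "\<dots> = ?m (H True True True) + ?m (H True True False) + (?m (H True False True) +
      ?m (H True False False))"
    by (subst (1 2) measure_lebesgue_disjoint_Un[OF m m d]) auto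
  finally have h: "?T / 2 = ?m (H True True True) + ?m (H True True False) + (?m (H True False True) +
      ?m (H True False False))"
    using measure_half_ball[OF u0] by linarith
  \<comment> \<open>The antipodal map exchanges opposite cells up to points on the three planes, where a closed
  condition becomes an open one.\<close>
  have "?m (H True False True) = ?m ((\<lambda>x. - x) ` H False True False)"
  proof (rule measure_negligible_symdiff[symmetric])
    show "negligible (H True False True - (\<lambda>x. - x) ` H False True False \<union>
        ((\<lambda>x. - x) ` H False True False - H True False True))"
    proof (rule negligible_subset)
      show "negligible ({x. u \<bullet> x = 0} \<union> {x. v \<bullet> x = 0} \<union> {x. w \<bullet> x = 0})"
        using unit by (auto intro!: negligible_Un negligible_hyperplane)
      show "H True False True - (\<lambda>x. - x) ` H False True False \<union>
          ((\<lambda>x. - x) ` H False True False - H True False True) \<subseteq> {x. u \<bullet> x = 0} \<union> {x. v \<bullet> x =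
          0} \<union> {x. w \<bullet> x = 0}"
      proof
        fix x assume x: "x \<in> H True False True - (\<lambda>x. - x) ` H False True False \<union>
            ((\<lambda>x. - x) ` H False True False - H True False True)"
        have "x \<in> (\<lambda>x. - x) ` H False True False \<longleftrightarrow> - x \<in> H False True False"
            by (metis add.inverse_inverse image_iff)
        with x show "x \<in> {x. u \<bullet> x = 0} \<union> {x. v \<bullet> x = 0} \<union> {x. w \<bullet> x = 0}"
          by (auto simp: H_def)
      qed
    qed
  qed (rule m)
  also have "\<dots> = ?m (H False True False)"
    by (rule measure_orthogonal_image) (auto simp: m orthogonal_transformation_def linear_iff)
  finally have s: "?m (H True False True) = ?m (H False True False)" .
  have "2 * ?m (H True True True) = ?T - ?m (wedge u v) - ?m (wedge u w) - ?m (wedge v w)"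
    using h w1 w2 w3 s by linarith
  also have "\<dots> = ?T / (2 * pi) * (2 * pi - arccos (u \<bullet> v) - arccos (u \<bullet> w) - arccos (v \<bullet> w))"
    by (simp add: measure_wedge unit field_simps)
  finally have "?m (H True True True) = ?T / (4 * pi) * (2 *
      pi - arccos (u \<bullet> v) - arccos (u \<bullet> w) - arccos (v \<bullet> w))"
    by simp
  then show ?thesis by (simp add: H_def)
qed

section \<open>The area of a regular spherical polygon\<close>

text \<open>
  The half-plane bounded by the polar axis and containing the corner \<open>k\<close> lies in the plane
  orthogonal to this vector.
\<close>

definition meridian_normal :: "nat \<Rightarrow> nat \<Rightarrow> real^3" where
  "meridian_normal n k = vector [- sin (2 * pi * real k / real n), cos (2 * pi * real k / real n), 0]"

text \<open>
  The unit normal, pointing to the interior, of the plane through the side from corner \<open>k\<close> to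
  corner \<open>k + 1\<close>; the midpoint of this side has longitude \<open>pi * (2 * k + 1) / n\<close>.
\<close>

definition side_normal :: "nat \<Rightarrow> real \<Rightarrow> nat \<Rightarrow> real^3" where
  "side_normal n a k =
     (let r = circumradius n a; t = pi * (2 * real k + 1) / real n
      in vector [- cos r * cos t, - cos r * sin t, sin r * cos (pi / real n)] /\<^sub>R cos (a / 2))"

text \<open>
  Sign conditions on two meridian planes describe the longitudes in the sector between them. The
  conclusion fails without the bound \<open>s + d \<le> 2 * pi\<close>, as longitudes are taken in \<open>[0, 2 * pi)\<close>.
\<close>

lemma sin_sector_iff:
  assumes "0 \<le> s" "s + d \<le> 2 * pi" "0 < d" "d < pi" "0 \<le> t" "t < 2 * pi"
  shows "0 \<le> sin (t - s) \<and> sin (t - (s + d)) < 0 \<longleftrightarrow> s \<le> t \<and> t < s + d"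
proof
  assume *: "0 \<le> sin (t - s) \<and> sin (t - (s + d)) < 0"
  have per: "sin (t - x) = sin (t - x + 2 * pi)" for x by simp
  have "s \<le> t"
  proof (rule ccontr)
    assume "\<not> s \<le> t"
    have "t - s \<le> - pi"
      using * \<open>\<not> s \<le> t\<close> sin_lt_zero[of "t - s + 2 * pi"] per[of s] assms by linarith
    then have "0 \<le> sin (t - (s + d) + 2 * pi)"
      using assms by (intro sin_ge_zero) linarith+
    with * per[of "s + d"] show False by linarith
  qed
  moreover have "t - s \<le> pi"
    using * sin_lt_zero[of "t - s"] assms by linarith
  moreover have "t < s + d"
    using * sin_ge_zero[of "t - (s + d)"] \<open>t - s \<le> pi\<close> assms by linarith
  ultimately show "s \<le> t \<and> t < s + d" by simp
next
  assume "s \<le> t \<and> t < s + d"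
  then show "0 \<le> sin (t - s) \<and> sin (t - (s + d)) < 0"
    using assms sin_gt_zero[of "s + d - t"] sin_minus[of "s + d - t"]
    by (auto intro!: sin_ge_zero)
qed

lemma cos_le_cos_far:
  assumes "0 \<le> h" "h \<le> y" "y \<le> 2 * pi - h"
  shows "cos y \<le> cos h"
proof (cases "y \<le> pi")
  case True
  then show ?thesis using assms by (intro cos_monotone_0_pi_le) auto
next
  case False
  have "cos (2 * pi - y) \<le> cos h" using assms False by (intro cos_monotone_0_pi_le) auto
  then show ?thesis by simp
qed

context
  fixes n :: nat and a :: real
  assumes n: "3 \<le> n" and a: "0 < a" "a \<le> 2 * pi / real n"
begin

lemma cos_half_side: "0 < cos (a / 2)"
  using half_angles[OF n a] by (intro cos_gt_zero_pi) linarith+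

lemma cos_half_side_squared:
  "(cos (a / 2))\<^sup>2 = (cos (circumradius n a))\<^sup>2 + (sin (circumradius n a))\<^sup>2 * (cos (pi / n))\<^sup>2"
proof -
  have "(sin (a / 2))\<^sup>2 = (sin (circumradius n a))\<^sup>2 * (sin (pi / n))\<^sup>2"
    using circumradius_props(1)[OF n a] by (metis power_mult_distrib)
  then show ?thesis
    by (simp add: cos_squared_eq algebra_simps)
qed

lemma cross_corners:
  "corner n a k \<times> corner n a (Suc k) =
     (2 * sin (circumradius n a) * sin (pi / n) * cos (a / 2)) *\<^sub>R side_normal n a k"
proof -
  define r t h where "r = circumradius n a" and "t = 2 * pi * real k / n" and "h = pi / n"
  have ang: "2 * pi * real (Suc k) / n = t + h + h" "pi * (2 * real k + 1) / n = t + h"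
    using n_pos[OF n a] by (simp_all add: t_def h_def field_simps)
  have s: "sin (t + h + h) = sin (t + h) * cos h + cos (t + h) * sin h"
    "cos (t + h + h) = cos (t + h) * cos h - sin (t + h) * sin h"
    "sin t = sin (t + h) * cos h - cos (t + h) * sin h"
    "cos t = cos (t + h) * cos h + sin (t + h) * sin h"
    using sin_add[of "t + h" h] cos_add[of "t + h" h] sin_diff[of "t + h" h] cos_diff[of "t + h" h] by simp_all
  have x: "sin (t + h + h) - sin t = 2 * cos (t + h) * sin h"
    and y: "cos t - cos (t + h + h) = 2 * sin (t + h) * sin h"
    unfolding s by simp_all
  have z: "cos t * sin (t + h + h) - sin t * cos (t + h + h) = 2 * sin h * cos h"
    using sin_diff[of "t + h + h" t] sin_double[of h] by (simp add: algebra_simps)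
  let ?s = "sin r" and ?q = "cos r"
  have "corner n a k \<times> corner n a (Suc k) =
      (2 * ?s * sin h) *\<^sub>R vector [- ?q * cos (t + h), - ?q * sin (t + h), ?s * cos h]"
    unfolding vec_eq_iff forall_3 corner_def Let_def ang r_def[symmetric] t_def[symmetric] cross3_def vector_3 vector_scaleR_component real_scaleR_def
  proof (intro conjI)
    show "?s * sin t * ?q - ?q * (?s * sin (t + h + h)) = 2 * ?s * sin h * (- ?q * cos (t + h))"
      using x by algebra
    show "?q * (?s * cos (t + h + h)) - ?s * cos t * ?q = 2 * ?s * sin h * (- ?q * sin (t + h))"
      using y by algebra
    show "?s * cos t * (?s * sin (t + h + h)) - ?s * sin t * (?s * cos (t + h + h)) =
        2 * ?s * sin h * (?s * cos h)"
      using z by algebra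
  qed
  then show ?thesis
    using cos_half_side by (simp add: side_normal_def Let_def ang r_def h_def)
qed

lemma side_condition_iff:
  "0 \<le> (corner n a k \<times> corner n a (Suc k)) \<bullet> x \<longleftrightarrow> 0 \<le> side_normal n a k \<bullet> x"
proof -
  have pos: "0 < 2 * sin (circumradius n a) * sin (pi / n) * cos (a / 2)"
    using sin_pos[OF n a] circumradius_props[OF n a] cos_half_side by simp
  show ?thesis
    unfolding cross_corners inner_scaleR_left
    using mult_le_cancel_left_pos[OF pos, of 0 "side_normal n a k \<bullet> x"] by (simp only: mult_zero_right)
qed

lemma norm_side_normal: "norm (side_normal n a k) = 1"
proof -
  define t where "t = pi * (2 * real k + 1) / n"
  have "(cos (circumradius n a))\<^sup>2 * (cos t)\<^sup>2 + (cos (circumradius n a))\<^sup>2 * (sin t)\<^sup>2 =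
      (cos (circumradius n a))\<^sup>2"
    unfolding distrib_left[symmetric] by simp
  then have "(norm (vector [- cos (circumradius n a) * cos t, - cos (circumradius n a) * sin t,
      sin (circumradius n a) * cos (pi / n)] :: real^3))\<^sup>2 = (cos (a / 2))\<^sup>2"
    unfolding power2_norm_eq_inner cos_half_side_squared
    by (simp add: inner_vec_def sum_3 power_mult_distrib power2_eq_square[symmetric])
  then have "norm (vector [- cos (circumradius n a) * cos t, - cos (circumradius n a) * sin t,
      sin (circumradius n a) * cos (pi / n)] :: real^3) = cos (a / 2)"
    using cos_half_side by (simp add: power2_eq_iff_nonneg)
  then show ?thesis
    using cos_half_side by (simp add: side_normal_def Let_def t_def)
qed

lemma norm_meridian_normal: "norm (meridian_normal n k) = 1"
  by (simp add: norm_eq_1 meridian_normal_def inner_vec_def sum_3 power2_eq_square[symmetric])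

lemma arccos_meridian_meridian:
  "arccos (meridian_normal n k \<bullet> (- meridian_normal n (Suc k))) = pi - 2 * pi / n"
proof -
  have "2 * pi * real (Suc k) / n = 2 * pi * real k / n + 2 * pi / n"
    using n_pos[OF n a] by (simp add: field_simps)
  then have "meridian_normal n k \<bullet> (- meridian_normal n (Suc k)) =
      - cos (2 * pi * real k / n + 2 * pi / n - 2 * pi * real k / n)"
    unfolding cos_diff by (simp add: meridian_normal_def inner_vec_def sum_3 del: add_diff_cancel_left')
  also have "\<dots> = cos (pi - 2 * pi / n)" by simp
  finally show ?thesis
    using half_angles[OF n a] by (simp only:) (rule arccos_cos; simp add: mult.commute)
qed

lemma interior_angle_bounds: "0 \<le> interior_angle n a" "interior_angle n a \<le> pi"
  and cos_half_interior_angle: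
    "cos (interior_angle n a / 2) = cos (circumradius n a) * sin (pi / n) / cos (a / 2)"
proof -
  define q where "q = cos (pi / n) / cos (a / 2)"
  have "0 \<le> cos (pi / n)" "cos (pi / n) \<le> cos (a / 2)"
    using half_angles[OF n a] by (intro cos_ge_zero cos_monotone_0_pi_le; linarith)+
  then have q: "0 \<le> q" "q \<le> 1" using cos_half_side by (auto simp: q_def)
  have b: "interior_angle n a = 2 * arcsin q"
    unfolding q_def by (rule interior_angle_eq[OF n a])
  show "0 \<le> interior_angle n a" "interior_angle n a \<le> pi"
    using q arcsin_le_arcsin[of 0 q] arcsin_ubound[of q] unfolding b by auto
  have "cos (arcsin q) = sqrt (1 - q\<^sup>2)"
    using q by (simp add: cos_arcsin)
  also have "1 - q\<^sup>2 = (cos (circumradius n a) * sin (pi / n) / cos (a / 2))\<^sup>2"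
    using cos_half_side cos_half_side_squared
    by (simp add: q_def field_simps power_mult_distrib sin_squared_eq power_divide)
  also have "sqrt \<dots> = cos (circumradius n a) * sin (pi / n) / cos (a / 2)"
    using cos_half_side sin_pos[OF n a] circumradius_props[OF n a] by simp
  finally show "cos (interior_angle n a / 2) = cos (circumradius n a) * sin (pi / n) / cos (a / 2)"
    by (simp add: b)
qed

lemma arccos_meridian_side:
  "arccos (meridian_normal n k \<bullet> side_normal n a k) = pi - interior_angle n a / 2"
  "arccos (- meridian_normal n (Suc k) \<bullet> side_normal n a k) = pi - interior_angle n a / 2"
proof -
  define t h where "t = 2 * pi * real k / n" and "h = pi / n"
  have ang: "2 * pi * real (Suc k) / n = t + h + h" "pi * (2 * real k + 1) / n = t + h"
    using n_pos[OF n a] by (simp_all add: t_def h_def field_simps)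
  have c: "cos (pi - interior_angle n a / 2) = - (cos (circumradius n a) * sin h / cos (a / 2))"
    unfolding cos_pi_minus cos_half_interior_angle h_def ..
  have *: "arccos (cos (pi - interior_angle n a / 2)) = pi - interior_angle n a / 2"
    using interior_angle_bounds by (intro arccos_cos) linarith+
  let ?q = "cos (circumradius n a)" and ?c = "inverse (cos (a / 2))"
  have "meridian_normal n k \<bullet> side_normal n a k =
      (- sin t) * (?c * (- ?q * cos (t + h))) + cos t * (?c * (- ?q * sin (t + h)))"
    unfolding meridian_normal_def side_normal_def Let_def ang t_def[symmetric] inner_vec_def sum_3 by simp
  also have "\<dots> = - (?q * (sin (t + h) * cos t - cos (t + h) * sin t) * ?c)"
    by (simp add: algebra_simps)
  also have "\<dots> = cos (pi - interior_angle n a / 2)"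
    unfolding sin_diff[symmetric] c by (simp only: divide_inverse add_diff_cancel_left')
  finally show "arccos (meridian_normal n k \<bullet> side_normal n a k) = pi - interior_angle n a / 2"
    using * by simp
  have "- meridian_normal n (Suc k) \<bullet> side_normal n a k =
      sin (t + h + h) * (?c * (- ?q * cos (t + h))) - cos (t + h + h) * (?c * (- ?q * sin (t + h)))"
    unfolding meridian_normal_def side_normal_def Let_def ang inner_vec_def sum_3 by simp
  also have "\<dots> = - (?q * (sin (t + h + h) * cos (t + h) - cos (t + h + h) * sin (t + h)) * ?c)"
    by (simp add: algebra_simps)
  also have "\<dots> = cos (pi - interior_angle n a / 2)"
    unfolding sin_diff[symmetric] c by (simp only: divide_inverse add_diff_cancel_left')
  finally show "arccos (- meridian_normal n (Suc k) \<bullet> side_normal n a k) = pi - interior_angle n a / 2"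
    using * by simp
qed

text \<open>
  The cone over the triangle formed by the centre of the polygon and the side \<open>k\<close>. The open
  condition on one meridian plane keeps distinct sectors disjoint.
\<close>

definition polygon_sector :: "nat \<Rightarrow> (real^3) set" where
  "polygon_sector k = {x \<in> cball 0 1. 0 \<le> meridian_normal n k \<bullet> x \<and> meridian_normal n (Suc k) \<bullet> x < 0
      \<and> 0 \<le> side_normal n a k \<bullet> x}"

lemma polygon_sector_lmeasurable: "polygon_sector k \<in> lmeasurable"
proof (rule lmeasurable_in_cball)
  show "polygon_sector k \<in> sets borel" unfolding polygon_sector_def by measurable
qed (auto simp: polygon_sector_def)

text \<open>
  The triangle has the angle \<open>2 * pi / n\<close> at the centre, and half of the interior angle of the
  polygon at the two other corners.
\<close>

lemma measure_polygon_sector: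
  "measure lebesgue (polygon_sector k) = (2 * pi / n + interior_angle n a - pi) / 3"
proof -
  let ?Q = "{x \<in> cball 0 1. 0 \<le> meridian_normal n k \<bullet> x \<and> 0 \<le> - meridian_normal n (Suc k) \<bullet> x \<and>
      0 \<le> side_normal n a k \<bullet> x}"
  have "measure lebesgue ?Q = measure lebesgue (polygon_sector k)"
  proof (rule measure_negligible_symdiff[OF polygon_sector_lmeasurable])
    show "negligible (polygon_sector k - ?Q \<union> (?Q - polygon_sector k))"
      by (rule negligible_subset[OF negligible_hyperplane[of "meridian_normal n (Suc k)" 0]])
        (use norm_meridian_normal[of "Suc k"] in \<open>auto simp: polygon_sector_def\<close>)
  qed
  moreover have "measure lebesgue ?Q = (4 / 3 * pi) / (4 * pi) * (2 * pi - (pi - 2 * pi / n)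
     - (pi - interior_angle n a / 2) - (pi - interior_angle n a / 2))"
    by (subst measure_trihedral_cone)
      (simp_all only: norm_minus_cancel norm_meridian_normal norm_side_normal arccos_meridian_meridian arccos_meridian_side,
       simp add: content_cball eval_unit_ball_vol)
  ultimately have "measure lebesgue (polygon_sector k) = (4 / 3 * pi) / (4 * pi) * (2 * pi - (pi - 2 * pi / n)
     - (pi - interior_angle n a / 2) - (pi - interior_angle n a / 2))" by (simp only:)
  moreover define z where "z = 2 * pi / n"
  ultimately show ?thesis by (fold z_def) (simp add: field_simps)
qed

text \<open>
  In cylindrical coordinates, the condition for the side \<open>j\<close> bounds the height from below by a
  multiple of the cosine of the distance in longitude to the midpoint of the side. For points of
  the sector \<open>k\<close> this cosine is largest for \<open>j = k\<close>, so the side \<open>k\<close> alone decides. The points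
  outside of all sectors are those on the polar axis.
\<close>

lemma polygon_cone_decomposition:
  defines "P \<equiv> {x \<in> cball 0 1. \<forall>k<n. 0 \<le> side_normal n a k \<bullet> x}"
  shows "disjoint_family_on polygon_sector {..<n}"
    and "(\<Union>k<n. polygon_sector k) \<subseteq> P"
    and "P - (\<Union>k<n. polygon_sector k) \<subseteq> {x. axis 1 1 \<bullet> x = 0}"
proof -
  define h where "h = pi / n"
  define r where "r = circumradius n a"
  have h: "0 < h" "2 * h < pi" "real n * h = pi"
    using half_angles[OF n a] n_pos[OF n a] by (auto simp: h_def mult.commute)
  have t: "2 * pi * real k / n = 2 * h * real k" "pi * (2 * real k + 1) / n = 2 * h * real k + h" for k
    using n_pos[OF n a] by (simp_all add: h_def field_simps)
  have kn: "2 * h * real k + 2 * h \<le> 2 * pi" if "k < n" for k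
  proof -
    have "h * (real k + 1) \<le> h * real n" using that h by (intro mult_left_mono) auto
    then show ?thesis using h by (simp add: algebra_simps)
  qed
  have polar: "\<exists>p s. x $ 1 = p * cos s \<and> x $ 2 = p * sin s \<and> 0 \<le> p \<and> 0 \<le> s \<and> s < 2 * pi" for x :: "real^3"
  proof -
    define p where "p = sqrt ((x $ 1)\<^sup>2 + (x $ 2)\<^sup>2)"
    show ?thesis
    proof (cases "p = 0")
      case True
      then have "x $ 1 = 0" "x $ 2 = 0" by (auto simp: p_def)
      then show ?thesis by (intro exI[of _ 0]) auto
    next
      case False
      then have "(x $ 1 / p)\<^sup>2 + (x $ 2 / p)\<^sup>2 = 1"
        by (simp add: p_def power_divide add_divide_distrib[symmetric])
      then obtain s where "0 \<le> s" "s < 2 * pi" "x $ 1 / p = cos s" "x $ 2 / p = sin s"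
        using sincos_total_2pi by blast
      then show ?thesis using False
        by (intro exI[of _ p] exI[of _ s]) (auto simp: p_def field_simps)
    qed
  qed
  have mer: "meridian_normal n k \<bullet> x = p * sin (s - 2 * h * real k)"
    if "x $ 1 = p * cos s" "x $ 2 = p * sin s" for x p s k
    unfolding meridian_normal_def t using that by (simp add: inner_vec_def sum_3 sin_diff algebra_simps)
  have side: "side_normal n a k \<bullet> x = (sin r * cos h * x $ 3 - cos r * p * cos (s - (2 * h * real k +
      h))) / cos (a / 2)"
    if "x $ 1 = p * cos s" "x $ 2 = p * sin s" for x p s k
  proof -
    have "vector [- cos r * cos (2 * h * real k + h), - cos r * sin (2 * h * real k + h), sin r * cos h] \<bullet> x =
        sin r * cos h * x $ 3 - cos r * p * cos (s - (2 * h * real k + h))"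
      unfolding cos_diff using that by (simp add: inner_vec_def sum_3 algebra_simps)
    then show ?thesis
      unfolding side_normal_def t Let_def r_def[symmetric] h_def[symmetric] inner_scaleR_left
      by (simp only: divide_inverse mult.commute)
  qed
  have sector_iff: "0 \<le> meridian_normal n k \<bullet> x \<and> meridian_normal n (Suc k) \<bullet> x < 0 \<longleftrightarrow>
      0 < p \<and> 2 * h * real k \<le> s \<and> s < 2 * h * real k + 2 * h"
    if x: "x $ 1 = p * cos s" "x $ 2 = p * sin s" and p: "0 \<le> p" "0 \<le> s" "s < 2 * pi" and k: "k < n" for x p s k
  proof (cases "p = 0")
    case False
    have "2 * h * real (Suc k) = 2 * h * real k + 2 * h" by (simp add: algebra_simps)
    then show ?thesis
      using sin_sector_iff[of "2 * h * real k" "2 * h" s] kn[OF k] h p False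
      by (simp only: mer[OF x]) (auto simp: zero_le_mult_iff mult_less_0_iff)
  qed (simp add: mer[OF x])
  show "disjoint_family_on polygon_sector {..<n}"
  proof -
    have "k = j" if "k < n" "j < n" "x \<in> polygon_sector k" "x \<in> polygon_sector j" for x k j
    proof -
      obtain p s where x: "x $ 1 = p * cos s" "x $ 2 = p * sin s" and p: "0 \<le> p" "0 \<le> s" "s < 2 * pi"
        using polar by blast
      have "2 * h * real k < 2 * h * (real j + 1)" "2 * h * real j < 2 * h * (real k + 1)"
        using that(3,4) sector_iff[OF x p that(1)] sector_iff[OF x p that(2)]
        by (simp_all add: polygon_sector_def distrib_left)
      then show "k = j" using h by simp
    qed
    then show ?thesis by (auto simp: disjoint_family_on_def)
  qed
  have nearest: "0 \<le> side_normal n a j \<bullet> x"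
    if x: "x $ 1 = p * cos s" "x $ 2 = p * sin s" and p: "0 \<le> p" "0 \<le> s" "s < 2 * pi" and kj: "k < n" "j < n"
    and s: "2 * h * real k \<le> s" "s < 2 * h * real k + 2 * h" and nn: "0 \<le> side_normal n a k \<bullet> x" for x p s k j
  proof -
    have "cos (s - (2 * h * real j + h)) \<le> cos (s - (2 * h * real k + h))"
    proof (cases "j = k")
      case False
      have "cos h \<le> cos \<bar>s - (2 * h * real k + h)\<bar>"
        using s h by (intro cos_monotone_0_pi_le) auto
      moreover have "cos \<bar>s - (2 * h * real j + h)\<bar> \<le> cos h"
      proof (rule cos_le_cos_far)
        have "h \<le> s - (2 * h * real j + h) \<or> h \<le> (2 * h * real j + h) - s"
        proof (cases "j < k")
          case True
          then have "2 * h * (real j + 1) \<le> 2 * h * real k" using h by (intro mult_left_mono) auto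
          then show ?thesis using s by (simp add: algebra_simps)
        next
          case False
          then have "2 * h * (real k + 1) \<le> 2 * h * real j" using h \<open>j \<noteq> k\<close> by (intro mult_left_mono) auto
          then show ?thesis using s by (simp add: algebra_simps)
        qed
        then show "h \<le> \<bar>s - (2 * h * real j + h)\<bar>" by linarith
        have "0 \<le> 2 * h * real j" using h by simp
        then show "\<bar>s - (2 * h * real j + h)\<bar> \<le> 2 * pi - h"
          using kn[OF kj(1)] kn[OF kj(2)] s p h by linarith
      qed (use h in auto)
      ultimately show ?thesis by simp
    qed simp
    moreover have "0 \<le> cos r * p" using p circumradius_props[OF n a] by (simp add: r_def)
    ultimately have "cos r * p * cos (s - (2 * h * real j + h)) \<le> cos r * p * cos (s - (2 * h * real k + h))"
      by (rule mult_left_mono)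
    moreover have "0 \<le> sin r * cos h * x $ 3 - cos r * p * cos (s - (2 * h * real k + h))"
      using nn cos_half_side unfolding side[OF x] by (simp add: zero_le_divide_iff)
    ultimately show ?thesis
      using cos_half_side unfolding side[OF x] by (simp add: zero_le_divide_iff)
  qed
  show "(\<Union>k<n. polygon_sector k) \<subseteq> P"
  proof
    fix x assume "x \<in> (\<Union>k<n. polygon_sector k)"
    then obtain k where k: "k < n" "x \<in> polygon_sector k" by auto
    obtain p s where x: "x $ 1 = p * cos s" "x $ 2 = p * sin s" and p: "0 \<le> p" "0 \<le> s" "s < 2 * pi"
      using polar by blast
    show "x \<in> P"
      using k sector_iff[OF x p] nearest[OF x p k(1)] unfolding P_def polygon_sector_def by auto
  qed
  show "P - (\<Union>k<n. polygon_sector k) \<subseteq> {x. axis 1 1 \<bullet> x = 0}"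
  proof
    fix x assume x': "x \<in> P - (\<Union>k<n. polygon_sector k)"
    obtain p s where x: "x $ 1 = p * cos s" "x $ 2 = p * sin s" and p: "0 \<le> p" "0 \<le> s" "s < 2 * pi"
      using polar by blast
    have "p = 0"
    proof (rule ccontr)
      assume "p \<noteq> 0"
      \<comment> \<open>The number of the sector that contains the longitude \<open>s\<close>, as each sector has the width \<open>2 * h\<close>.\<close>
      define k where "k = nat \<lfloor>s / (2 * h)\<rfloor>"
      have rk: "real k = of_int \<lfloor>s / (2 * h)\<rfloor>" using p h by (simp add: k_def)
      have "real k \<le> s / (2 * h)" "s / (2 * h) < real k + 1" unfolding rk by linarith+
      then have k: "2 * h * real k \<le> s" "s < 2 * h * real k + 2 * h"
        using h by (auto simp: field_simps)
      have "2 * h * real k < 2 * h * real n" using k p h by (simp add: mult.assoc mult.commute[of h])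
      then have "k < n" using h by (subst (asm) mult_less_cancel_left_pos) auto
      have "x \<in> polygon_sector k"
        using sector_iff[OF x p \<open>k < n\<close>] k p \<open>p \<noteq> 0\<close> x' \<open>k < n\<close> by (auto simp: polygon_sector_def P_def)
      then show False using x' \<open>k < n\<close> by auto
    qed
    then show "x \<in> {x. axis 1 1 \<bullet> x = 0}" using x by (simp add: inner_axis')
  qed
qed

theorem area_regular_polygon:
  "spherical_area (\<Delta> n a) = real n * interior_angle n a - (real n - 2) * pi"
proof -
  let ?P = "{x \<in> cball 0 1. \<forall>k<n. 0 \<le> side_normal n a k \<bullet> x}"
  have region: "\<Delta> n a = {x \<in> sphere 0 1. \<forall>k<n. 0 \<le> side_normal n a k \<bullet> x}"
  proof (rule set_eqI)
    fix x
    have "x \<in> \<Delta> n a \<longleftrightarrow> (\<forall>k<n. norm x = 1 \<and> 0 \<le> side_normal n a k \<bullet> x)"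
      by (simp add: regular_polygon_def polygon_region_def hemisphere_def side_condition_iff INT_iff) (simp add: Ball_def)
    then show "x \<in> \<Delta> n a \<longleftrightarrow> x \<in> {x \<in> sphere 0 1. \<forall>k<n. 0 \<le> side_normal n a k \<bullet> x}"
      using n by (auto dest: spec[of _ 0])
  qed
  have pole: "axis 3 1 \<in> \<Delta> n a"
    unfolding region using pole_inner_north[OF n a] side_condition_iff by (auto intro: less_imp_le)
  have "{t *\<^sub>R x |t x. 0 \<le> t \<and> t \<le> 1 \<and> x \<in> \<Delta> n a} = ?P" (is "?L = _")
  proof (intro set_eqI iffI)
    fix y assume y: "y \<in> ?P"
    show "y \<in> ?L"
    proof (cases "y = 0")
      case True
      then show ?thesis using pole by (intro CollectI exI[of _ 0] exI[of _ "axis 3 1"]) simp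
    next
      case False
      then show ?thesis using y
        by (intro CollectI exI[of _ "norm y"] exI[of _ "y /\<^sub>R norm y"]) (simp add: region)
    qed
  qed (auto simp: region)
  moreover have "measure lebesgue ?P = measure lebesgue (\<Union>k<n. polygon_sector k)"
  proof (rule measure_negligible_symdiff)
    show "(\<Union>k<n. polygon_sector k) \<in> lmeasurable"
      by (rule fmeasurable.finite_UN) (auto simp: polygon_sector_lmeasurable)
    show "negligible ((\<Union>k<n. polygon_sector k) - ?P \<union> (?P - (\<Union>k<n. polygon_sector k)))"
      by (rule negligible_subset[OF negligible_hyperplane[of "axis 1 1" 0]])
        (use polygon_cone_decomposition in auto)
  qed
  moreover have "\<dots> = (\<Sum>k<n. measure lebesgue (polygon_sector k))"
    using polygon_cone_decomposition(1)
    by (intro measure_finite_Union) (auto intro: fmeasurableD polygon_sector_lmeasurable simp: fmeasurableD2[OF polygon_sector_lmeasurable])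
  ultimately have "spherical_area (\<Delta> n a) = 3 * (\<Sum>k<n. measure lebesgue (polygon_sector k))"
    by (simp only: spherical_area_def)
  also have "\<dots> = real n * (2 * pi / n) + real n * interior_angle n a - real n * pi"
    by (simp add: measure_polygon_sector right_diff_distrib distrib_left)
  finally show ?thesis
    using n_pos[OF n a] by (simp add: algebra_simps)
qed

end

section \<open>Connected components of a graph and of its dual\<close>

text \<open>
  Edges are labels with a set of ends rather than sets of vertices, so that the same label can be
  an edge between two vertices and a dual edge between two faces.
\<close>

definition link :: "('e \<Rightarrow> 'a set) \<Rightarrow> 'e set \<Rightarrow> ('a \<times> 'a) set" where
  "link ends S = {(u, v). \<exists>e\<in>S. u \<in> ends e \<and> v \<in> ends e}"

definition reach :: "('e \<Rightarrow> 'a set) \<Rightarrow> 'e set \<Rightarrow> 'a \<Rightarrow> 'a set" where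
  "reach ends S u = (link ends S)\<^sup>* `` {u}"

definition num_classes :: "('e \<Rightarrow> 'a set) \<Rightarrow> 'e set \<Rightarrow> 'a set \<Rightarrow> nat" where
  "num_classes ends S V = card (reach ends S ` V)"

lemma reach_refl: "u \<in> reach ends S u"
  by (simp add: reach_def)

lemma reach_mono: "S \<subseteq> T \<Longrightarrow> reach ends S u \<subseteq> reach ends T u"
  unfolding reach_def by (intro Image_mono rtrancl_mono) (auto simp: link_def)

lemma reach_step:
  assumes "v \<in> reach ends S u" "e \<in> S" "v \<in> ends e" "w \<in> ends e"
  shows "w \<in> reach ends S u"
proof -
  have "(v, w) \<in> link ends S" using assms by (auto simp: link_def)
  then show ?thesis using assms(1) by (auto simp: reach_def intro: rtrancl_into_rtrancl)
qed

lemma reach_subset: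
  assumes "u \<in> C" "\<And>e v w. e \<in> S \<Longrightarrow> v \<in> ends e \<Longrightarrow> w \<in> ends e \<Longrightarrow> v \<in> C \<Longrightarrow> w \<in> C"
  shows "reach ends S u \<subseteq> C"
proof
  fix w assume "w \<in> reach ends S u"
  then have "(u, w) \<in> (link ends S)\<^sup>*" by (simp add: reach_def)
  then show "w \<in> C"
    by (induction rule: rtrancl_induct) (use assms in \<open>auto simp: link_def\<close>)
qed

lemma reach_eq: "v \<in> reach ends S u \<Longrightarrow> reach ends S v = reach ends S u"
proof -
  have "sym (link ends S)" by (auto simp: sym_def link_def)
  then have "sym ((link ends S)\<^sup>*)" by (rule sym_rtrancl)
  then show "v \<in> reach ends S u \<Longrightarrow> reach ends S v = reach ends S u"
    by (auto simp: reach_def dest: symD intro: rtrancl_trans)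
qed

lemma reach_empty: "reach ends {} u = {u}"
  using reach_subset[of u "{u}" "{}" ends] reach_refl[of u ends "{}"] by auto

lemma reach_insert:
  assumes "ends e = {u, v}"
  shows "reach ends (insert e S) x =
    (if x \<in> reach ends S u \<union> reach ends S v then reach ends S u \<union> reach ends S v else reach ends S x)"
proof (cases "x \<in> reach ends S u \<union> reach ends S v")
  case True
  let ?C = "reach ends S u \<union> reach ends S v"
  have "reach ends (insert e S) x \<subseteq> ?C"
  proof (rule reach_subset[OF True])
    fix e' y z assume "e' \<in> insert e S" "y \<in> ends e'" "z \<in> ends e'" "y \<in> ?C"
    then show "z \<in> ?C"
      using assms reach_refl[of u ends S] reach_refl[of v ends S] reach_step[of y ends S _ e' z] by auto
  qed
  moreover have "?C \<subseteq> reach ends (insert e S) x"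
  proof -
    let ?R = "reach ends (insert e S)"
    have uv: "v \<in> ?R u"
      by (rule reach_step[OF reach_refl, of e]) (auto simp: assms)
    have sub: "?C \<subseteq> ?R u"
      using reach_mono[of S "insert e S" ends] reach_eq[OF uv] by blast
    with True have "x \<in> ?R u" by blast
    then show ?thesis using sub reach_eq by metis
  qed
  ultimately show ?thesis using True by auto
next
  case False
  have "reach ends (insert e S) x \<subseteq> reach ends S x"
  proof (rule reach_subset[OF reach_refl])
    fix e' y z assume *: "e' \<in> insert e S" "y \<in> ends e'" "z \<in> ends e'" "y \<in> reach ends S x"
    have "y \<noteq> u" "y \<noteq> v" using * False reach_eq reach_refl by (metis UnCI)+
    then show "z \<in> reach ends S x"
      using * assms reach_step[of y ends S x e' z] by auto
  qed
  then show ?thesis using False reach_mono[of S "insert e S" ends x] by auto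
qed

text \<open>
  A new edge merges the classes of its two ends, and leaves the other classes as they are.
\<close>

lemma num_classes_insert:
  assumes fin: "finite V" and e: "ends e = {u, v}" and uv: "u \<in> V" "v \<in> V"
  shows "num_classes ends S V = num_classes ends (insert e S) V + (if v \<in> reach ends S u then 0 else 1)"
proof (cases "v \<in> reach ends S u")
  case True
  then have *: "reach ends S v = reach ends S u" by (rule reach_eq)
  have "reach ends (insert e S) x = reach ends S x" for x
    unfolding reach_insert[where ends = ends and e = e, OF e] * using reach_eq[of x ends S u] by auto
  then show ?thesis using True by (simp add: num_classes_def)
next
  case False
  let ?R = "reach ends S"
  let ?A = "?R u" and ?B = "?R v"
  have AB: "?A \<noteq> ?B" using False reach_refl by metis
  have "reach ends (insert e S) ` V = insert (?A \<union> ?B) (?R ` V - {?A, ?B})" (is "?L = ?R'")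
  proof
    show "?L \<subseteq> ?R'"
    proof
      fix X assume "X \<in> ?L"
      then obtain x where "x \<in> V" "X = reach ends (insert e S) x" by auto
      then show "X \<in> ?R'"
        unfolding reach_insert[where ends = ends and e = e, OF e]
        using reach_refl[of x ends S] by (auto split: if_splits)
    qed
    show "?R' \<subseteq> ?L"
    proof
      fix X assume "X \<in> ?R'"
      then consider "X = ?A \<union> ?B" | x where "x \<in> V" "X = ?R x" "?R x \<noteq> ?A" "?R x \<noteq> ?B" by auto
      then show "X \<in> ?L"
      proof cases
        case 1
        have "reach ends (insert e S) u = X"
          unfolding reach_insert[where ends = ends and e = e, OF e] 1 using reach_refl[of u ends S] by simp
        then show ?thesis using uv by blast
      next
        case 2
        have "reach ends (insert e S) x = X" unfolding reach_insert[where ends = ends and e = e, OF e]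
          using 2 reach_eq[of x ends S u] reach_eq[of x ends S v] by auto
        then show ?thesis using 2 by blast
      qed
    qed
  qed
  moreover have "?A \<union> ?B \<notin> ?R ` V"
  proof
    assume "?A \<union> ?B \<in> ?R ` V"
    then obtain x where x: "?R x = ?A \<union> ?B" by auto
    then have "u \<in> ?R x" "v \<in> ?R x" using reach_refl[of u ends S] reach_refl[of v ends S] by auto
    then have "?A = ?B" using reach_eq by metis
    with AB show False by simp
  qed
  ultimately have "card (reach ends (insert e S) ` V) = Suc (card (?R ` V - {?A, ?B}))"
    using fin by simp
  moreover have "card (?R ` V) = card (?R ` V - {?A, ?B}) + 2"
  proof -
    have "card (?R ` V - {?A, ?B}) = card (?R ` V) - card {?A, ?B}"
      using uv by (intro card_Diff_subset) auto
    moreover have "card {?A, ?B} \<le> card (?R ` V)"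
      using uv fin by (intro card_mono) auto
    ultimately show ?thesis using AB by simp
  qed
  ultimately show ?thesis using False by (simp add: num_classes_def)
qed

lemma num_classes_empty: "num_classes ends {} V = card V"
  by (simp add: num_classes_def reach_empty card_image)

lemma num_classes_connected:
  assumes "V \<noteq> {}" "\<And>u v. u \<in> V \<Longrightarrow> v \<in> V \<Longrightarrow> v \<in> reach ends S u"
  shows "num_classes ends S V = 1"
proof -
  obtain u where u: "u \<in> V" using assms by auto
  have "reach ends S ` V = {reach ends S u}"
    using u assms(2) reach_eq by fastforce
  then show ?thesis by (simp add: num_classes_def)
qed

lemma sum_card_incident:
  assumes "finite C" "finite K"
  shows "(\<Sum>x\<in>C. card {e \<in> K. x \<in> ends e}) = (\<Sum>e\<in>K. card (ends e \<inter> C))"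
proof -
  have "(\<Sum>x\<in>C. card {e \<in> K. x \<in> ends e}) = (\<Sum>x\<in>C. \<Sum>e\<in>K. if x \<in> ends e then 1 else 0)"
    using assms by (simp add: sum.If_cases Int_def)
  also have "\<dots> = (\<Sum>e\<in>K. \<Sum>x\<in>C. if x \<in> ends e then 1 else 0)"
    by (rule sum.swap)
  also have "\<dots> = (\<Sum>e\<in>K. card (ends e \<inter> C))"
    using assms by (simp add: sum.If_cases Int_def conj_commute)
  finally show ?thesis .
qed

text \<open>
  The sum of the degrees over \<open>W\<close> counts the edges inside \<open>W\<close> twice and those that leave \<open>W\<close> once.
\<close>

lemma even_cut:
  assumes fin: "finite B" "finite W"
    and ends: "\<And>e. e \<in> B \<Longrightarrow> card (ends e) = 2"
    and even: "\<And>x. x \<in> W \<Longrightarrow> even (card {e \<in> B. x \<in> ends e})"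
  shows "even (card {e \<in> B. card (ends e \<inter> W) = 1})"
proof -
  have le: "card (ends e \<inter> W) \<le> 2" if "e \<in> B" for e
    using ends[OF that] by (metis card.infinite card_mono finite.emptyI inf_le1 zero_neq_numeral)
  have "even (\<Sum>x\<in>W. card {e \<in> B. x \<in> ends e})"
    using even by (rule dvd_sum)
  then have "even (\<Sum>e\<in>B. card (ends e \<inter> W))"
    using sum_card_incident[OF fin(2,1), of ends] by simp
  also have "(\<Sum>e\<in>B. card (ends e \<inter> W)) =
      (\<Sum>e\<in>B. (if card (ends e \<inter> W) = 1 then 1 else 0) + 2 * (if card (ends e \<inter> W) = 2 then 1 else 0))"
    using le by (intro sum.cong) (auto simp: le_Suc_eq numeral_2_eq_2)
  also have "\<dots> = card {e \<in> B. card (ends e \<inter> W) = 1} + 2 * (\<Sum>e\<in>B. if card (ends e \<inter> W) = 2 then 1 else 0)"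
    using fin by (simp add: sum.distrib sum_distrib_left[symmetric] sum.If_cases Int_def)
  finally show ?thesis by simp
qed

text \<open>
  Let \<open>W\<close> be the component of \<open>u\<close> in \<open>S\<close>. The edges that leave \<open>W\<close> contain \<open>e\<close> and avoid \<open>S\<close>, and
  as dual edges they have even degree at each face. Without \<open>e\<close> the degree is odd at \<open>f\<close> and \<open>g\<close>
  only, and a component of the dual graph cannot contain exactly one vertex of odd degree; so \<open>f\<close>
  and \<open>g\<close> lie in the same one.
\<close>

lemma dual_reach_if_not_reach:
  assumes fin: "finite E" "finite V" "finite F"
    and pe: "\<And>e. e \<in> E \<Longrightarrow> pe e \<subseteq> V \<and> card (pe e) = 2"
    and de: "\<And>e. e \<in> E \<Longrightarrow> de e \<subseteq> F \<and> card (de e) = 2"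
    and even: "\<And>f W. f \<in> F \<Longrightarrow> W \<subseteq> V \<Longrightarrow> even (card {e \<in> E. f \<in> de e \<and> card (pe e \<inter> W) = 1})"
    and S: "S \<subseteq> E" and e: "e \<in> E" "e \<notin> S" "pe e = {u, v}" "de e = {f, g}"
    and nreach: "v \<notin> reach pe S u"
  shows "g \<in> reach de (E - S - {e}) f"
proof (rule ccontr)
  assume ng: "g \<notin> reach de (E - S - {e}) f"
  define W where "W = reach pe S u"
  \<comment> \<open>The cut of the graph around \<open>W\<close>.\<close>
  define K where "K = {e' \<in> E. card (pe e' \<inter> W) = 1}"
  define C where "C = reach de (K - {e}) f"
  have WV: "W \<subseteq> V"
  proof (unfold W_def, rule reach_subset)
    show "u \<in> V" using pe[OF e(1)] e(3) by auto
    show "w \<in> V" if "e' \<in> S" "w \<in> pe e'" for e' w using pe[of e'] that S by auto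
  qed
  have "pe e \<inter> W = {u}" using nreach reach_refl[of u pe S] by (auto simp: W_def e)
  then have eK: "e \<in> K" using e by (simp add: K_def)
  have "K \<inter> S = {}"
  proof -
    have "card (pe e' \<inter> W) \<noteq> 1" if "e' \<in> S" for e'
    proof
      assume 1: "card (pe e' \<inter> W) = 1"
      then obtain z where z: "pe e' \<inter> W = {z}" by (auto simp: card_1_singleton_iff)
      then have "pe e' \<subseteq> W" using reach_step[of z pe S u e'] that by (auto simp: W_def)
      then have "pe e' \<inter> W = pe e'" by auto
      then show False using 1 pe[of e'] that S by auto
    qed
    then show ?thesis by (auto simp: K_def)
  qed
  then have sub: "K - {e} \<subseteq> E - S - {e}" by (auto simp: K_def)
  from reach_mono[OF sub, of de f] have gC: "g \<notin> C" using ng unfolding C_def by blast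
  have fC: "f \<in> C" by (simp add: C_def reach_refl)
  have fK: "finite K" using fin by (simp add: K_def)
  have fF: "f \<in> F" using de[OF e(1)] e(4) by auto
  have CF: "C \<subseteq> F"
  proof (unfold C_def, rule reach_subset[OF fF])
    show "w \<in> F" if "e' \<in> K - {e}" "w \<in> de e'" for e' w using de[of e'] that by (auto simp: K_def)
  qed
  have finC: "finite C" by (rule finite_subset[OF CF fin(3)])
  have evK: "even (card {e' \<in> K. x \<in> de e'})" if "x \<in> F" for x
    using even[OF that WV] by (simp add: K_def conj_ac)
  have "even (\<Sum>x\<in>C. card {e' \<in> K - {e}. x \<in> de e'})"
  proof -
    have "even (card (de e' \<inter> C))" if e': "e' \<in> K - {e}" for e'
    proof (cases "de e' \<inter> C = {}")
      case False
      then obtain z where "z \<in> de e'" "z \<in> C" by auto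
      then have "de e' \<subseteq> C" using reach_step[of z de "K - {e}" f e'] e' by (auto simp: C_def)
      then have "de e' \<inter> C = de e'" by auto
      then show ?thesis using de[of e'] e' by (simp add: K_def)
    qed simp
    then show ?thesis
      unfolding sum_card_incident[OF finC finite_Diff[OF fK]] by (rule dvd_sum)
  qed
  also have "(\<Sum>x\<in>C. card {e' \<in> K - {e}. x \<in> de e'}) =
      card {e' \<in> K - {e}. f \<in> de e'} + (\<Sum>x\<in>C - {f}. card {e' \<in> K - {e}. x \<in> de e'})"
    using finC fC by (rule sum.remove)
  finally have "even (card {e' \<in> K - {e}. f \<in> de e'} + (\<Sum>x\<in>C - {f}. card {e' \<in> K - {e}. x \<in> de e'}))" .
  moreover have "even (\<Sum>x\<in>C - {f}. card {e' \<in> K - {e}. x \<in> de e'})"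
  proof (rule dvd_sum)
    fix x assume x: "x \<in> C - {f}"
    then have "{e' \<in> K - {e}. x \<in> de e'} = {e' \<in> K. x \<in> de e'}" using gC e by auto
    then show "even (card {e' \<in> K - {e}. x \<in> de e'})" using evK[of x] x CF by auto
  qed
  moreover have "odd (card {e' \<in> K - {e}. f \<in> de e'})"
  proof -
    have "{e' \<in> K. f \<in> de e'} = insert e {e' \<in> K - {e}. f \<in> de e'}" using eK e by auto
    then have "card {e' \<in> K. f \<in> de e'} = Suc (card {e' \<in> K - {e}. f \<in> de e'})"
      using fK by simp
    then show ?thesis using evK[OF fF] by simp
  qed
  ultimately show False by simp
qed

text \<open>
  The number of components of \<open>S\<close> plus the number of edges in \<open>S\<close> exceeds the number of components
  of the dual graph by a constant: each new edge either decreases the first number by one, or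
  increases the last number by one. The two extreme cases \<open>S = {}\<close> and \<open>S = E\<close> give the formula.
\<close>

lemma euler_from_duality:
  assumes fin: "finite E" "finite V" "finite F"
    and pe: "\<And>e. e \<in> E \<Longrightarrow> pe e \<subseteq> V \<and> card (pe e) = 2"
    and de: "\<And>e. e \<in> E \<Longrightarrow> de e \<subseteq> F \<and> card (de e) = 2"
    and conn: "num_classes pe E V = 1" "num_classes de E F = 1"
    and dual: "\<And>S e u v f g. S \<subseteq> E \<Longrightarrow> e \<in> E \<Longrightarrow> e \<notin> S \<Longrightarrow> pe e = {u, v} \<Longrightarrow> de e = {f, g} \<Longrightarrow>
      v \<in> reach pe S u \<longleftrightarrow> g \<notin> reach de (E - S - {e}) f"
  shows "card V + card F = card E + 2"
proof -
  have "num_classes pe S V + card S + 1 = card V + num_classes de (E - S) F" if "S \<subseteq> E" for S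
    using finite_subset[OF that fin(1)] that
  proof (induction S rule: finite_induct)
    case empty
    then show ?case using conn by (simp add: num_classes_empty)
  next
    case (insert e S)
    then have e: "e \<in> E" "e \<notin> S" "S \<subseteq> E" by auto
    obtain u v where uv: "pe e = {u, v}" using pe[OF e(1)] by (auto simp: card_2_iff)
    obtain f g where fg: "de e = {f, g}" using de[OF e(1)] by (auto simp: card_2_iff)
    have "E - S = Set.insert e (E - Set.insert e S)" using e by auto
    moreover have "E - Set.insert e S = E - S - {e}" by auto
    ultimately have 1: "num_classes de (E - Set.insert e S) F =
        num_classes de (E - S) F + (if g \<in> reach de (E - S - {e}) f then 0 else 1)"
      using num_classes_insert[of F de e f g "E - S - {e}"] fin fg de[OF e(1)] by auto
    have 2: "num_classes pe S V = num_classes pe (Set.insert e S) V + (if v \<in> reach pe S u then 0 else 1)"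
      using num_classes_insert[of V pe e u v S] fin uv pe[OF e(1)] by auto
    have 3: "v \<in> reach pe S u \<longleftrightarrow> g \<notin> reach de (E - S - {e}) f"
      by (rule dual) (use e uv fg in auto)
    have "card (Set.insert e S) = Suc (card S)" using insert by simp
    then show ?case using 1 2 3 insert.IH[OF e(3)] by (auto split: if_splits)
  qed
  from this[of E] show ?thesis using conn by (simp add: num_classes_empty)
qed

section \<open>Simple closed curves on the sphere\<close>

text \<open>
  Stereographic projection, with values in the complex numbers, where the Jordan curve theorem is
  stated.
\<close>

lemma punctured_sphere_homeomorphic_plane:
  fixes p :: "real^3"
  assumes "p \<in> sphere 0 1"
  obtains \<phi> \<psi> where "homeomorphism (sphere 0 1 - {p}) (UNIV :: complex set) \<phi> \<psi>"
proof -
  have "sphere 0 1 - {p} homeomorphic {x :: real^3. axis 3 1 \<bullet> x = 0}"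
    using assms by (intro homeomorphic_punctured_sphere_hyperplane) (auto simp: axis_eq_0_iff)
  moreover have "{x :: real^3. axis 3 1 \<bullet> x = 0} homeomorphic (UNIV :: complex set)"
    by (rule homeomorphic_affine_sets) (auto simp: affine_hyperplane aff_dim_hyperplane axis_eq_0_iff)
  ultimately have "sphere 0 1 - {p} homeomorphic (UNIV :: complex set)"
    by (rule homeomorphic_trans)
  then show ?thesis using that by (auto simp: homeomorphic_def)
qed

lemma connected_sphere_diff_finite:
  fixes F :: "(real^3) set"
  assumes "finite F"
  shows "connected (sphere 0 1 - F)"
proof (cases "sphere 0 1 \<inter> F = {}")
  case True
  then have "sphere 0 1 - F = sphere 0 1" by auto
  then show ?thesis by (simp add: connected_sphere)
next
  case False
  then obtain p where p: "p \<in> sphere 0 1" "p \<in> F" by auto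
  obtain \<phi> \<psi> where h: "homeomorphism (sphere 0 1 - {p}) (UNIV :: complex set) \<phi> \<psi>"
    using punctured_sphere_homeomorphic_plane[OF p(1)] .
  let ?F = "\<phi> ` (sphere 0 1 \<inter> F - {p})"
  have "connected (- ?F)"
    using assms by (intro path_connected_imp_connected path_connected_complement_countable) (auto intro: countable_finite)
  then have "connected (\<psi> ` (- ?F))"
    using h by (intro connected_continuous_image) (auto simp: homeomorphism_def intro: continuous_on_subset)
  moreover have "\<psi> ` (- ?F) = sphere 0 1 - F"
  proof
    show "\<psi> ` (- ?F) \<subseteq> sphere 0 1 - F"
    proof
      fix y assume "y \<in> \<psi> ` (- ?F)"
      then obtain z where z: "y = \<psi> z" "z \<notin> ?F" by auto
      have "y \<in> sphere 0 1 - {p}" "\<phi> y = z" using h z unfolding homeomorphism_def by blast+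
      moreover have "y \<notin> F"
      proof
        assume "y \<in> F"
        then have "z \<in> ?F" using calculation by (intro image_eqI[of _ _ y]) auto
        with z show False by simp
      qed
      ultimately show "y \<in> sphere 0 1 - F" by blast
    qed
    show "sphere 0 1 - F \<subseteq> \<psi> ` (- ?F)"
    proof
      fix y assume y: "y \<in> sphere 0 1 - F"
      then have "y \<in> sphere 0 1 - {p}" using p by auto
      moreover have "\<phi> y \<notin> ?F"
      proof
        assume "\<phi> y \<in> ?F"
        then obtain z where "z \<in> sphere 0 1 \<inter> F - {p}" "\<phi> y = \<phi> z" by blast
        then have "y = z" using h \<open>y \<in> sphere 0 1 - {p}\<close>
            by (metis DiffD1 DiffD2 DiffI IntD1 homeomorphism_apply1)
        then show False using y \<open>z \<in> _\<close> by auto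
      qed
      ultimately show "y \<in> \<psi> ` (- ?F)"
        using homeomorphism_apply1[OF h] by (metis ComplI image_eqI)
    qed
  qed
  ultimately show ?thesis by simp
qed

text \<open>
  The point \<open>p\<close> off the curve is the centre of the projection. It is added to the image of the
  outside, and the result is open at \<open>p\<close> too, because the inside together with the curve is
  compact.
\<close>

lemma Jordan_curve_sphere:
  fixes c :: "real \<Rightarrow> real^3"
  assumes c: "simple_path c" "pathfinish c = pathstart c" "path_image c \<subseteq> sphere 0 1"
    and p: "p \<in> sphere 0 1" "p \<notin> path_image c"
  obtains U W where "openin (top_of_set (sphere 0 1)) U" "openin (top_of_set (sphere 0 1)) W"
    "U \<inter> W = {}" "U \<union> W = sphere 0 1 - path_image c"
    "path_image c \<subseteq> closure U" "path_image c \<subseteq> closure W"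
proof -
  obtain \<phi> \<psi> where h: "homeomorphism (sphere 0 1 - {p}) (UNIV :: complex set) \<phi> \<psi>"
    using punctured_sphere_homeomorphic_plane[OF p(1)] .
  have h1: "\<psi> (\<phi> x) = x" if "x \<in> sphere 0 1 - {p}" for x
    using h that by (auto simp: homeomorphism_def)
  have h2: "\<phi> (\<psi> z) = z" for z using h by (auto simp: homeomorphism_def)
  have h3: "\<psi> z \<in> sphere 0 1 - {p}" for z using h unfolding homeomorphism_def by (metis UNIV_I image_eqI)
  have inj: "inj \<psi>" by (metis h2 injI)
  have cont: "continuous_on S \<psi>" for S
    using h by (auto simp: homeomorphism_def intro: continuous_on_subset)
  have sub: "path_image c \<subseteq> sphere 0 1 - {p}" using c p by auto
  define d where "d = \<phi> \<circ> c"
  have d: "simple_path d" unfolding d_def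
  proof (rule simple_path_continuous_image[OF c(1)])
    show "continuous_on (path_image c) \<phi>"
      using h sub by (auto simp: homeomorphism_def intro: continuous_on_subset)
    show "inj_on \<phi> (path_image c)"
      by (rule inj_on_inverseI[of _ \<psi>]) (use h1 sub in blast)
  qed
  have dloop: "pathfinish d = pathstart d"
    using c(2) by (simp add: d_def pathfinish_compose pathstart_compose)
  have im: "\<psi> ` path_image d = path_image c"
    unfolding d_def path_image_compose image_comp using h1 sub by (force simp: image_iff)
  note J = Jordan_inside_outside[OF d dloop]
  define U where "U = \<psi> ` inside (path_image d)"
  define W where "W = sphere 0 1 - (path_image c \<union> U)"
  have cl: "closure (inside (path_image d)) = inside (path_image d) \<union> path_image d"
    "closure (outside (path_image d)) = outside (path_image d) \<union> path_image d"
    using J closure_Un_frontier by metis+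
  have disj: "inside (path_image d) \<inter> path_image d = {}" "outside (path_image d) \<inter> path_image d = {}"
    by (auto simp: inside_no_overlap outside_no_overlap)
  have Uc: "U \<inter> path_image c = {}"
    unfolding U_def im[symmetric] image_Int[OF inj, symmetric] disj by simp
  have Usub: "U \<subseteq> sphere 0 1" using h3 by (auto simp: U_def)
  show ?thesis
  proof
    have "openin (top_of_set (sphere 0 1 - {p})) U"
      unfolding U_def using J
      by (intro homeomorphism_imp_open_map[OF homeomorphism_symD[OF h]]) auto
    moreover have "openin (top_of_set (sphere 0 1)) (sphere 0 1 - {p})"
      by (simp add: openin_delete)
    ultimately show "openin (top_of_set (sphere 0 1)) U" by (rule openin_trans)
    have "compact (closure (inside (path_image d)))" using J by (simp add: compact_closure)
    then have "compact (\<psi> ` closure (inside (path_image d)))"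
      using cont by (intro compact_continuous_image)
    also have "\<psi> ` closure (inside (path_image d)) = path_image c \<union> U"
      unfolding cl image_Un U_def im by auto
    finally have "closed (path_image c \<union> U)" by (rule compact_imp_closed)
    then show "openin (top_of_set (sphere 0 1)) W"
      unfolding W_def by (metis Diff_eq open_Compl openin_open_Int)
    show "U \<inter> W = {}" by (auto simp: W_def)
    show "U \<union> W = sphere 0 1 - path_image c" using Uc Usub by (auto simp: W_def)
    have clo: "\<psi> ` closure S \<subseteq> closure (\<psi> ` S)" for S
      by (rule image_closure_subset) (auto simp: cont closure_subset)
    show "path_image c \<subseteq> closure U"
      using clo[of "inside (path_image d)"] unfolding cl U_def[symmetric] image_Un im by auto
    have "\<psi> ` outside (path_image d) \<subseteq> W"
    proof -
      have "\<psi> ` outside (path_image d) \<inter> path_image c = {}"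
        unfolding im[symmetric] image_Int[OF inj, symmetric] disj by simp
      moreover have "\<psi> ` outside (path_image d) \<inter> U = {}"
        unfolding U_def image_Int[OF inj, symmetric] using J by (simp add: Int_commute)
      ultimately show ?thesis using h3 unfolding W_def by blast
    qed
    then have "closure (\<psi> ` outside (path_image d)) \<subseteq> closure W" by (rule closure_mono)
    then show "path_image c \<subseteq> closure W"
      using clo[of "outside (path_image d)"] unfolding cl image_Un im by auto
  qed
qed

lemma circle_loop_at:
  assumes J: "sphere (0 :: real^2) 1 homeomorphic J" and x: "x \<in> J"
  obtains \<gamma> where "simple_path \<gamma>" "path_image \<gamma> = J" "pathstart \<gamma> = x" "pathfinish \<gamma> = x"
proof -
  have "sphere (0 :: complex) 1 homeomorphic sphere (0 :: real^2) 1"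
    by (rule homeomorphic_spheres') auto
  then have "sphere (0 :: complex) 1 homeomorphic J"
    using J by (rule homeomorphic_trans)
  then obtain f g where h: "homeomorphism (sphere (0 :: complex) 1) J f g"
    by (auto simp: homeomorphic_def)
  define z where "z = g x"
  have "z \<in> sphere 0 1" "f z = x" using h x unfolding z_def homeomorphism_def by blast+
  define b where "b = Arg z"
  have b: "z = cis b"
    using \<open>z \<in> sphere 0 1\<close> cis_Arg[of z] by (cases "z = 0") (auto simp: b_def sgn_div_norm)
  \<comment> \<open>Once around the circle, beginning and ending at the point that corresponds to \<open>x\<close>.\<close>
  define \<delta> where "\<delta> = (\<lambda>t. cis (2 * pi * t + b))"
  have inj: "s = t \<or> s = 0 \<and> t = 1 \<or> s = 1 \<and> t = 0"
    if "s \<in> {0..1}" "t \<in> {0..1}" "\<delta> s = \<delta> t" for s t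
  proof -
    have "cis (2 * pi * s + b) / cis (2 * pi * t + b) = 1" using that by (simp add: \<delta>_def)
    then have "cis (2 * pi * (s - t)) = 1" by (simp add: cis_divide algebra_simps)
    then have "cos (2 * pi * (s - t)) = 1" by (metis cis.sel(1) one_complex.sel(1))
    then obtain m :: int where "2 * pi * (s - t) = of_int m * 2 * pi" using cos_one_2pi_int by blast
    then have m: "s - t = of_int m" by simp
    then have "-1 \<le> (of_int m :: real)" "(of_int m :: real) \<le> 1" using that by auto
    then have "m = -1 \<or> m = 0 \<or> m = 1" by auto
    then show ?thesis using m that by auto
  qed
  have "path \<delta>" unfolding path_def \<delta>_def by (intro continuous_intros)
  then have sp: "simple_path \<delta>" using inj by (auto simp: simple_path_def loop_free_def)
  have im: "path_image \<delta> = sphere 0 1"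
  proof
    show "path_image \<delta> \<subseteq> sphere 0 1" by (auto simp: path_image_def \<delta>_def)
    show "sphere 0 1 \<subseteq> path_image \<delta>"
    proof
      fix w :: complex assume "w \<in> sphere 0 1"
      then have "w * cis (- b) \<in> sphere 0 1" by (simp add: norm_mult)
      then have "(Re (w * cis (- b)))\<^sup>2 + (Im (w * cis (- b)))\<^sup>2 = 1"
          by (simp add: cmod_power2[symmetric] del: times_complex.sel)
      then obtain t where t: "0 \<le> t" "t < 2 * pi" "Re (w * cis (- b)) = cos t" "Im (w * cis (- b)) = sin t"
        using sincos_total_2pi by blast
      then have "w * cis (- b) = cis t" by (intro complex_eqI) simp_all
      then have "w * cis (- b) * cis b = cis (t + b)" by (simp add: cis_mult)
      then have "w = \<delta> (t / (2 * pi))" by (simp add: \<delta>_def mult.assoc cis_mult)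
      then show "w \<in> path_image \<delta>" using t unfolding path_image_def
          by (intro image_eqI[of _ _ "t / (2 * pi)"]) auto
    qed
  qed
  show ?thesis
  proof
    show "simple_path (f \<circ> \<delta>)"
      using h by (intro simple_path_continuous_image[OF sp]) (auto simp: im homeomorphism_def intro: inj_on_inverseI)
    show "path_image (f \<circ> \<delta>) = J" using h by (simp add: path_image_compose im homeomorphism_def)
    show "pathstart (f \<circ> \<delta>) = x" "pathfinish (f \<circ> \<delta>) = x"
      using \<open>f z = x\<close> b by (simp_all add: pathstart_def pathfinish_def \<delta>_def cis_mult[symmetric])
  qed
qed

text \<open>
  The parameter \<open>s\<close> cuts the curve into two compact pieces that meet only at the base point and at
  \<open>\<gamma> s\<close>; if \<open>C\<close> contained neither, then the pieces would disconnect it.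
\<close>

lemma simple_loop_connected_interval:
  fixes \<gamma> :: "real \<Rightarrow> 'a::t2_space"
  assumes \<gamma>: "simple_path \<gamma>" and C: "connected C" "C \<subseteq> path_image \<gamma>" "pathstart \<gamma> \<notin> C" "pathfinish \<gamma> \<notin> C"
    and rst: "0 < r" "r < s" "s < t" "t < 1" and rt: "\<gamma> r \<in> C" "\<gamma> t \<in> C"
  shows "\<gamma> s \<in> C"
proof (rule ccontr)
  assume s: "\<gamma> s \<notin> C"
  let ?P = "\<gamma> ` {0..s}" and ?Q = "\<gamma> ` {s..1}"
  have cont: "continuous_on {0..1} \<gamma>" using \<gamma> by (simp add: simple_path_def path_def)
  have "compact ?P" "compact ?Q"
    using rst by (auto intro!: compact_continuous_image continuous_on_subset[OF cont])
  then have "closed ?P" "closed ?Q" by (auto intro: compact_imp_closed)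
  moreover have "{0..1} = {0..s} \<union> {s..1}" using rst by auto
  then have "C \<subseteq> ?P \<union> ?Q" using C(2) unfolding path_image_def by (simp add: image_Un)
  moreover have "?P \<inter> ?Q \<inter> C = {}"
  proof -
    have "\<gamma> u = \<gamma> s \<or> \<gamma> u = pathstart \<gamma> \<or> \<gamma> u = pathfinish \<gamma>"
      if "u \<in> {0..s}" "v \<in> {s..1}" "\<gamma> u = \<gamma> v" for u v
    proof -
      have "u = v \<or> u = 0 \<and> v = 1 \<or> u = 1 \<and> v = 0"
      proof -
        have "u \<in> {0..1}" "v \<in> {0..1}" using that rst by auto
        then show ?thesis using \<gamma> that(3) by (simp add: simple_path_def loop_free_def)
      qed
      then show ?thesis using that by (auto simp: pathstart_def pathfinish_def)
    qed
    then show ?thesis using C s by (auto simp: image_iff) metis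
  qed
  moreover have "\<gamma> r \<in> ?P" "\<gamma> t \<in> ?Q" using rst by auto
  then have "?P \<inter> C \<noteq> {}" "?Q \<inter> C \<noteq> {}" using rt by blast+
  ultimately show False using connected_closedD[OF C(1), of ?P ?Q] by simp
qed

text \<open>
  If a closed curve is divided into finitely many pieces, then one of them contains points of
  arbitrarily small positive parameter. Two such pieces would have to alternate, but each of them
  is an interval of parameters.
\<close>

lemma loop_initial_piece:
  fixes \<gamma> :: "real \<Rightarrow> 'a::t2_space"
  assumes \<gamma>: "simple_path \<gamma>" "pathstart \<gamma> = x" "pathfinish \<gamma> = x"
    and I: "finite I" "path_image \<gamma> = (\<Union>i\<in>I. A i)"
    and A: "\<And>i. i \<in> I \<Longrightarrow> closed (A i)"
    and conn: "\<And>i. i \<in> I \<Longrightarrow> x \<in> A i \<Longrightarrow> connected (A i - {x})"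
    and int: "\<And>i j. i \<in> I \<Longrightarrow> j \<in> I \<Longrightarrow> i \<noteq> j \<Longrightarrow> x \<in> A i \<Longrightarrow> x \<in> A j \<Longrightarrow> A i \<inter> A j = {x}"
  shows "\<exists>!i. i \<in> I \<and> (\<forall>\<epsilon>>0. \<exists>t. 0 < t \<and> t < \<epsilon> \<and> t < 1 \<and> \<gamma> t \<in> A i)"
    and "i \<in> I \<Longrightarrow> (\<forall>\<epsilon>>0. \<exists>t. 0 < t \<and> t < \<epsilon> \<and> t < 1 \<and> \<gamma> t \<in> A i) \<Longrightarrow> x \<in> A i"
proof -
  let ?L = "\<lambda>i. \<forall>\<epsilon>>0. \<exists>t. 0 < t \<and> t < \<epsilon> \<and> t < 1 \<and> \<gamma> t \<in> A i"
  have cont: "continuous_on {0..1} \<gamma>" using \<gamma> by (simp add: simple_path_def path_def)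
  have ne: "\<gamma> t \<noteq> x" if "0 < t" "t < 1" for t
  proof
    assume "\<gamma> t = x"
    then have "\<gamma> t = \<gamma> 0" using \<gamma> by (simp add: pathstart_def)
    then show False using \<gamma>(1) that by (force simp: simple_path_def loop_free_def)
  qed
  have mem: "x \<in> A i" if i: "i \<in> I" and L: "?L i" for i
  proof -
    have "closed ({0..1} \<inter> \<gamma> -` A i)"
      using cont A[OF i] by (intro continuous_closed_preimage) auto
    moreover have "0 \<in> closure ({0..1} \<inter> \<gamma> -` A i)"
      unfolding closure_approachable
    proof (intro allI impI)
      fix \<epsilon> :: real assume "0 < \<epsilon>"
      with L obtain t where "0 < t" "t < \<epsilon>" "t < 1" "\<gamma> t \<in> A i" by blast
      then show "\<exists>y\<in>{0..1} \<inter> \<gamma> -` A i. dist y 0 < \<epsilon>" by (intro bexI[of _ t]) auto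
    qed
    ultimately have "\<gamma> 0 \<in> A i" by auto
    then show ?thesis using \<gamma> by (simp add: pathstart_def)
  qed
  then show "i \<in> I \<Longrightarrow> ?L i \<Longrightarrow> x \<in> A i" .
  have uniq: "i = j" if ij: "i \<in> I" "j \<in> I" and L: "?L i" "?L j" for i j
  proof (rule ccontr)
    assume "i \<noteq> j"
    obtain t where t: "0 < t" "t < 1" "\<gamma> t \<in> A i" using L(1) zero_less_one by blast
    obtain s where s: "0 < s" "s < t" "s < 1" "\<gamma> s \<in> A j" using L(2) t by blast
    obtain r where r: "0 < r" "r < s" "r < 1" "\<gamma> r \<in> A i" using L(1) s by blast
    have "\<gamma> s \<in> A i - {x}"
    proof (rule simple_loop_connected_interval[OF \<gamma>(1)])
      show "connected (A i - {x})" using conn mem ij L by blast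
      show "A i - {x} \<subseteq> path_image \<gamma>" using I ij by auto
    qed (use r s t ne \<gamma> in auto)
    then show False using int[OF ij \<open>i \<noteq> j\<close>] mem ij L s ne by blast
  qed
  have "\<exists>i\<in>I. ?L i"
  proof (rule ccontr)
    assume "\<not> ?thesis"
    then have "\<forall>i\<in>I. \<exists>\<epsilon>>0. \<forall>t. 0 < t \<and> t < \<epsilon> \<and> t < 1 \<longrightarrow> \<gamma> t \<notin> A i" by meson
    then obtain \<epsilon> where \<epsilon>: "\<And>i. i \<in> I \<Longrightarrow> 0 < \<epsilon> i"
      "\<And>i t. i \<in> I \<Longrightarrow> 0 < t \<Longrightarrow> t < \<epsilon> i \<Longrightarrow> t < 1 \<Longrightarrow> \<gamma> t \<notin> A i" by metis
    \<comment> \<open>The \<open>1\<close> keeps the parameter \<open>m / 2\<close> in the domain of \<open>\<gamma>\<close>.\<close>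
  define m where "m = Min (insert 1 (\<epsilon> ` I))"
    have m: "0 < m" "m \<le> 1" "\<And>i. i \<in> I \<Longrightarrow> m \<le> \<epsilon> i"
      using I(1) \<epsilon> by (auto simp: m_def)
    have "\<gamma> (m / 2) \<in> path_image \<gamma>" using m by (auto simp: path_image_def)
    then obtain i where "i \<in> I" "\<gamma> (m / 2) \<in> A i" using I by auto
    then show False using \<epsilon>(2)[of i "m / 2"] m(1,2) m(3)[of i] by auto
  qed
  then show "\<exists>!i. i \<in> I \<and> ?L i" using uniq by blast
qed

text \<open>
  Exactly two of the arcs of a subdivided circle end at a given point: one at the start and one at
  the end of a parametrisation based there. An arc that plays both parts would be an interval of
  parameters with both ends in the limit, that is, the whole circle.
\<close>

lemma loop_two_pieces:
  fixes \<gamma> :: "real \<Rightarrow> 'a::t2_space"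
  assumes \<gamma>: "simple_path \<gamma>" "pathstart \<gamma> = x" "pathfinish \<gamma> = x"
    and I: "finite I" "path_image \<gamma> = (\<Union>i\<in>I. A i)"
    and A: "\<And>i. i \<in> I \<Longrightarrow> closed (A i)"
    and conn: "\<And>i. i \<in> I \<Longrightarrow> x \<in> A i \<Longrightarrow> connected (A i - {x}) \<and> x \<in> closure (A i - {x})"
    and int: "\<And>i j. i \<in> I \<Longrightarrow> j \<in> I \<Longrightarrow> i \<noteq> j \<Longrightarrow> x \<in> A i \<Longrightarrow> x \<in> A j \<Longrightarrow> A i \<inter> A j = {x}"
    and proper: "\<And>i. i \<in> I \<Longrightarrow> A i \<noteq> path_image \<gamma>"
  shows "card {i \<in> I. x \<in> A i} = 2"
proof -
  define L where "L = (\<lambda>i. \<forall>\<epsilon>>0. \<exists>t. 0 < t \<and> t < \<epsilon> \<and> t < 1 \<and> \<gamma> t \<in> A i)"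
  define R where "R = (\<lambda>i. \<forall>\<epsilon>>0. \<exists>t. 0 < t \<and> t < \<epsilon> \<and> t < 1 \<and> reversepath \<gamma> t \<in> A i)"
  have conn': "\<And>i. i \<in> I \<Longrightarrow> x \<in> A i \<Longrightarrow> connected (A i - {x})" using conn by blast
  have rev: "simple_path (reversepath \<gamma>)" "pathstart (reversepath \<gamma>) = x" "pathfinish (reversepath \<gamma>) = x"
    "path_image (reversepath \<gamma>) = (\<Union>i\<in>I. A i)"
    using \<gamma> I by (auto simp: simple_path_reversepath)
  have exL: "\<exists>!i. i \<in> I \<and> L i" and memL: "\<And>i. i \<in> I \<Longrightarrow> L i \<Longrightarrow> x \<in> A i"
    using loop_initial_piece[of \<gamma> x I A, OF \<gamma> I A conn' int] unfolding L_def by blast+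
  have exR: "\<exists>!i. i \<in> I \<and> R i" and memR: "\<And>i. i \<in> I \<Longrightarrow> R i \<Longrightarrow> x \<in> A i"
    using loop_initial_piece[of "reversepath \<gamma>" x I A, OF rev(1-3) I(1) rev(4) A conn' int]
        unfolding R_def by blast+
  have cont: "continuous_on {0..1} \<gamma>" using \<gamma> by (simp add: simple_path_def path_def)
  have ne: "\<gamma> t \<noteq> x" if "0 < t" "t < 1" for t
  proof
    assume "\<gamma> t = x"
    then have "\<gamma> t = \<gamma> 0" using \<gamma> by (simp add: pathstart_def)
    then show False using \<gamma>(1) that by (force simp: simple_path_def loop_free_def)
  qed
  have param: "\<exists>t. 0 < t \<and> t < 1 \<and> y = \<gamma> t" if "y \<in> path_image \<gamma>" "y \<noteq> x" for y
  proof -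
    obtain t where t: "0 \<le> t" "t \<le> 1" "y = \<gamma> t" using \<open>y \<in> path_image \<gamma>\<close> by (auto simp: path_image_def)
    moreover have "t \<noteq> 0" "t \<noteq> 1" using t that \<gamma> by (auto simp: pathstart_def pathfinish_def)
    ultimately show ?thesis by (intro exI[of _ t]) auto
  qed
  have LR: "L i \<or> R i" if i: "i \<in> I" "x \<in> A i" for i
  proof (rule ccontr)
    assume "\<not> ?thesis"
    then obtain e1 e2 where e: "0 < e1" "0 < e2"
      "\<And>t. 0 < t \<Longrightarrow> t < e1 \<Longrightarrow> t < 1 \<Longrightarrow> \<gamma> t \<notin> A i"
      "\<And>t. 0 < t \<Longrightarrow> t < e2 \<Longrightarrow> t < 1 \<Longrightarrow> reversepath \<gamma> t \<notin> A i"
      unfolding L_def R_def by blast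
    \<comment> \<open>The two halves keep the interval from \<open>a\<close> to \<open>b\<close> nonempty and inside \<open>{0<..<1}\<close>, however
    large \<open>e1\<close> and \<open>e2\<close> are.\<close>
    define a b where "a = min e1 (1/2)" and "b = max (1 - e2) (1/2)"
    have ab: "0 < a" "b < 1" using e by (auto simp: a_def b_def)
    have "A i - {x} \<subseteq> \<gamma> ` {a..b}"
    proof
      fix y assume y: "y \<in> A i - {x}"
      then obtain t where t: "0 < t" "t < 1" "y = \<gamma> t" using param I i by blast
      have "\<not> t < e1" using e(3)[of t] t y by auto
      moreover have "\<not> 1 - t < e2" using e(4)[of "1 - t"] t y by (auto simp: reversepath_def)
      ultimately have "t \<in> {a..b}" using t by (auto simp: a_def b_def)
      then show "y \<in> \<gamma> ` {a..b}" using t by blast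
    qed
    moreover have "compact (\<gamma> ` {a..b})"
      using ab by (intro compact_continuous_image continuous_on_subset[OF cont]) auto
    ultimately have "closure (A i - {x}) \<subseteq> \<gamma> ` {a..b}"
      by (intro closure_minimal compact_imp_closed)
    then have "x \<in> \<gamma> ` {a..b}" using conn i by blast
    then obtain t where "a \<le> t" "t \<le> b" "x = \<gamma> t" by auto
    then show False using ne[of t] ab by auto
  qed
  have notboth: "\<not> (L i \<and> R i)" if i: "i \<in> I" for i
  proof
    assume LRi: "L i \<and> R i"
    then have x: "x \<in> A i" using memL i by blast
    have "\<gamma> s \<in> A i" if s: "0 < s" "s < 1" for s
    proof -
      have "0 < 1 - s" using s by simp
      obtain r where r: "0 < r" "r < s" "\<gamma> r \<in> A i"
        using LRi[unfolded L_def, THEN conjunct1, rule_format, OF s(1)] by auto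
      obtain t' where t': "0 < t'" "t' < 1 - s" "reversepath \<gamma> t' \<in> A i"
        using LRi[unfolded R_def, THEN conjunct2, rule_format, OF \<open>0 < 1 - s\<close>] by auto
      have "\<gamma> s \<in> A i - {x}"
      proof (rule simple_loop_connected_interval[OF \<gamma>(1), where t = "1 - t'" and r = r])
        show "connected (A i - {x})" using conn x i by blast
        show "A i - {x} \<subseteq> path_image \<gamma>" using I i by auto
        show "\<gamma> (1 - t') \<in> A i - {x}" using t' s ne[of "1 - t'"] by (auto simp: reversepath_def)
      qed (use r s t' ne \<gamma> in auto)
      then show ?thesis by simp
    qed
    then have "path_image \<gamma> \<subseteq> A i" using param x by blast
    then show False using proper[OF i] I i by blast
  qed
  obtain l where l: "l \<in> I" "L l" "\<And>i. i \<in> I \<Longrightarrow> L i \<Longrightarrow> i = l" using exL by metis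
  obtain r where r: "r \<in> I" "R r" "\<And>i. i \<in> I \<Longrightarrow> R i \<Longrightarrow> i = r" using exR by metis
  have "{i \<in> I. x \<in> A i} = {l, r}"
  proof (intro equalityI subsetI)
    show "i \<in> {l, r}" if "i \<in> {i \<in> I. x \<in> A i}" for i
      using that LR[of i] l(3)[of i] r(3)[of i] by blast
    show "i \<in> {i \<in> I. x \<in> A i}" if "i \<in> {l, r}" for i
      using that memL[OF l(1,2)] memR[OF r(1,2)] l(1) r(1) by auto
  qed
  moreover have "l \<noteq> r" using notboth[OF l(1)] l(2) r(2) by auto
  ultimately show ?thesis by simp
qed

section \<open>Faces, edges and vertices of a planar tessellation\<close>

definition face_boundary :: "'v embedded_graph \<Rightarrow> (real^3) set \<Rightarrow> 'v set set" where
  "face_boundary G f = {e \<in> edges G. edge_image G e \<subseteq> closure f}"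

definition faces_at :: "'v embedded_graph \<Rightarrow> 'v set \<Rightarrow> (real^3) set set" where
  "faces_at G e = {f \<in> faces G. edge_image G e \<subseteq> closure f}"

lemma mem_faces_at_iff: "e \<in> edges G \<Longrightarrow> f \<in> faces G \<Longrightarrow> f \<in> faces_at G e \<longleftrightarrow> e \<in> face_boundary G f"
  by (simp add: faces_at_def face_boundary_def)

context
  fixes G :: "'v embedded_graph"
  assumes planar: "finite_planar_graph G"
begin

lemma graph_embedded: "embedded G"
  using planar by (simp add: finite_planar_graph_def)

lemma finite_verts: "finite (verts G)"
  using planar by (simp add: finite_planar_graph_def)

lemma edge_subset: "e \<in> edges G \<Longrightarrow> e \<subseteq> verts G" and card_edge: "e \<in> edges G \<Longrightarrow> card e = 2"
  using graph_embedded by (simp_all add: embedded_def)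

lemma finite_edges: "finite (edges G)"
  using edge_subset finite_verts by (intro finite_subset[of "edges G" "Pow (verts G)"]) auto

lemma card_faces_at: "e \<in> edges G \<Longrightarrow> card (faces_at G e) = 2"
  using planar by (simp add: finite_planar_graph_def faces_at_def)

lemma arc_curve: "e \<in> edges G \<Longrightarrow> arc (curve G e)"
  and curve_ends: "e \<in> edges G \<Longrightarrow> {pathstart (curve G e), pathfinish (curve G e)} = pos G ` e"
  and edge_image_Int_verts: "e \<in> edges G \<Longrightarrow> edge_image G e \<inter> pos G ` verts G = pos G ` e"
  and edge_image_surface: "e \<in> edges G \<Longrightarrow> edge_image G e \<subseteq> surface G"
  and edge_image_Int: "e \<in> edges G \<Longrightarrow> e' \<in> edges G \<Longrightarrow> e \<noteq> e' \<Longrightarrow>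
    edge_image G e \<inter> edge_image G e' \<subseteq> pos G ` (e \<inter> e')"
  and inj_pos: "inj_on (pos G) (verts G)"
  using graph_embedded by (simp_all add: embedded_def)

lemma closed_edge_image: "e \<in> edges G \<Longrightarrow> closed (edge_image G e)"
  and compact_edge_image: "e \<in> edges G \<Longrightarrow> compact (edge_image G e)"
  using arc_curve by (auto simp: edge_image_def intro: closed_arc_image compact_arc_image)

lemma pos_in_edge_image: "e \<in> edges G \<Longrightarrow> x \<in> verts G \<Longrightarrow> pos G x \<in> edge_image G e \<longleftrightarrow> x \<in> e"
proof
  assume e: "e \<in> edges G" and x: "x \<in> verts G"
  have "pos G x \<in> edge_image G e \<longleftrightarrow> pos G x \<in> pos G ` e"
    using edge_image_Int_verts[OF e] x by blast
  then show "pos G x \<in> edge_image G e \<Longrightarrow> x \<in> e" "x \<in> e \<Longrightarrow> pos G x \<in> edge_image G e"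
    using inj_on_image_mem_iff[OF inj_pos x edge_subset[OF e]] by auto
qed

lemma edge_image_subset_graph: "e \<in> edges G \<Longrightarrow> edge_image G e \<subseteq> graph_image G"
  by (auto simp: graph_image_def)

lemma edges_eq_if_common_point:
  assumes "e \<in> edges G" "e' \<in> edges G" "p \<in> edge_image G e" "p \<in> edge_image G e'" "p \<notin> pos G ` verts G"
  shows "e = e'"
  using edge_image_Int[OF assms(1,2)] assms edge_subset[OF assms(1)] by blast

lemma degree_ge_3: "x \<in> verts G \<Longrightarrow> 3 \<le> vertex_degree G x" "f \<in> faces G \<Longrightarrow> 3 \<le> face_degree G f"
  using planar by (simp_all add: finite_planar_graph_def)

lemma face_degree_eq: "face_degree G f = card (face_boundary G f)"
  by (simp add: face_degree_def face_boundary_def)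

lemma face_boundary_subset: "face_boundary G f \<subseteq> edges G"
  by (auto simp: face_boundary_def)

lemma finite_face_boundary: "finite (face_boundary G f)"
  using face_boundary_subset finite_edges by (rule finite_subset)

lemma vertex_on_edge: "x \<in> verts G \<Longrightarrow> \<exists>e\<in>edges G. x \<in> e"
proof -
  assume "x \<in> verts G"
  then have "card {y \<in> verts G. {x, y} \<in> edges G} \<noteq> 0" using degree_ge_3(1)[of x]
      by (simp add: vertex_degree_def)
  then have "{y \<in> verts G. {x, y} \<in> edges G} \<noteq> {}" by (metis card.empty)
  then show ?thesis by auto
qed

lemma graph_image_eq: "graph_image G = (\<Union>e\<in>edges G. edge_image G e)"
proof -
  have "pos G ` verts G \<subseteq> (\<Union>e\<in>edges G. edge_image G e)"
  proof
    fix p assume "p \<in> pos G ` verts G"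
    then obtain x where x: "x \<in> verts G" "p = pos G x" by auto
    then obtain e where "e \<in> edges G" "x \<in> e" using vertex_on_edge by auto
    then show "p \<in> (\<Union>e\<in>edges G. edge_image G e)" using x pos_in_edge_image by auto
  qed
  then show ?thesis by (auto simp: graph_image_def)
qed

lemma compact_graph_image: "compact (graph_image G)"
  unfolding graph_image_eq using finite_edges compact_edge_image by (intro compact_UN) auto

lemma face_disjoint_graph: "f \<in> faces G \<Longrightarrow> f \<inter> graph_image G = {}"
  and face_surface: "f \<in> faces G \<Longrightarrow> f \<subseteq> surface G"
  using in_components_subset[of f "surface G - graph_image G"] by (auto simp: faces_def)

lemma face_connected: "f \<in> faces G \<Longrightarrow> connected f"
  by (auto simp: faces_def intro: in_components_connected)

lemma faces_disjoint: "f \<in> faces G \<Longrightarrow> g \<in> faces G \<Longrightarrow> f \<noteq> g \<Longrightarrow> f \<inter> g = {}"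
  unfolding faces_def using components_nonoverlap by blast

lemma Union_faces: "\<Union> (faces G) = surface G - graph_image G"
  by (simp add: faces_def)

lemma face_nonempty: "f \<in> faces G \<Longrightarrow> f \<noteq> {}"
  unfolding faces_def by (rule in_components_nonempty)

text \<open>
  The frontier of a face is covered by the edges that the disk condition provides; it is also the
  union of all edges contained in the closed face, as no edge meets an open face.
\<close>

lemma face_disk:
  assumes f: "f \<in> faces G"
  shows "compact (closure f)"
    and "sphere (0 :: real^2) 1 homeomorphic (closure f - f)"
    and "closure f - f = (\<Union>e\<in>face_boundary G f. edge_image G e)"
proof -
  have "disk_face G f" using planar f by (simp add: finite_planar_graph_def)
  then obtain h k B where h: "homeomorphism (cball (0::real^2) 1) (closure f) h k" "h ` ball 0 1 = f"
    and B: "B \<subseteq> edges G" "h ` sphere 0 1 = (\<Union>e\<in>B. edge_image G e)"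
    unfolding disk_face_def by blast
  have hc: "h ` cball 0 1 = closure f" and cont: "continuous_on (cball 0 1) h"
    and inj: "inj_on h (cball 0 1)"
    using h(1) by (auto simp: homeomorphism_def intro: inj_on_inverseI)
  show "compact (closure f)"
    using compact_continuous_image[OF cont compact_cball] by (simp add: hc)
  have "closure f - f = h ` (cball 0 1 - ball 0 1)"
    using inj_on_image_set_diff[OF inj, of "cball 0 1" "ball 0 1"] hc h(2) by auto
  then have diff: "closure f - f = h ` sphere 0 1" by (simp add: cball_diff_eq_sphere)
  have "homeomorphism (sphere (0::real^2) 1) (closure f - f) h k"
    by (rule homeomorphism_of_subsets[OF h(1)]) (auto simp: diff)
  then show "sphere (0 :: real^2) 1 homeomorphic (closure f - f)" by (auto simp: homeomorphic_def)
  show "closure f - f = (\<Union>e\<in>face_boundary G f. edge_image G e)"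
  proof
    have un: "closure f - f = (\<Union>e\<in>B. edge_image G e)" using diff B(2) by simp
    have "e \<in> face_boundary G f" if "e \<in> B" for e
      using that B(1) equalityD2[OF un] unfolding face_boundary_def by blast
    then show "closure f - f \<subseteq> (\<Union>e\<in>face_boundary G f. edge_image G e)"
      unfolding un by blast
    show "(\<Union>e\<in>face_boundary G f. edge_image G e) \<subseteq> closure f - f"
    proof
      fix p assume "p \<in> (\<Union>e\<in>face_boundary G f. edge_image G e)"
      then obtain e where e: "e \<in> edges G" "edge_image G e \<subseteq> closure f" "p \<in> edge_image G e"
        by (auto simp: face_boundary_def)
      then have "p \<notin> f" using face_disjoint_graph[OF f] edge_image_subset_graph[of e] by blast
      then show "p \<in> closure f - f" using e by blast
    qed
  qed
qed

lemma finite_faces: "finite (faces G)"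
proof (rule finite_subset)
  show "faces G \<subseteq> (\<Union>e\<in>edges G. faces_at G e)"
  proof
    fix f assume f: "f \<in> faces G"
    then have "card (face_boundary G f) \<noteq> 0" using degree_ge_3(2)[OF f] by (simp add: face_degree_eq)
    then have "face_boundary G f \<noteq> {}" by (metis card.empty)
    then show "f \<in> (\<Union>e\<in>edges G. faces_at G e)" using f by (auto simp: face_boundary_def faces_at_def)
  qed
  show "finite (\<Union>e\<in>edges G. faces_at G e)"
    using finite_edges card_faces_at by (intro finite_UN_I) (auto intro: card_ge_0_finite)
qed

text \<open>
  Closed faces are compact, and there are finitely many of them. So they cannot cover a plane.
\<close>

lemma surface_sphere: "surface G = sphere 0 1"
proof (rule ccontr)
  assume "surface G \<noteq> sphere 0 1"
  then have s: "surface G = {p. p $ 3 = 0}" using graph_embedded by (simp add: embedded_def)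
  have "bounded (graph_image G \<union> (\<Union>f\<in>faces G. closure f))"
    using finite_faces face_disk(1) compact_graph_image by (auto intro!: compact_imp_bounded)
  moreover have "surface G \<subseteq> graph_image G \<union> (\<Union>f\<in>faces G. closure f)"
  proof -
    have "\<Union> (faces G) \<subseteq> (\<Union>f\<in>faces G. closure f)" using closure_subset by blast
    then show ?thesis using Union_faces by blast
  qed
  ultimately have "bounded (surface G)" by (rule bounded_subset)
  then obtain b where b: "\<And>p. p \<in> surface G \<Longrightarrow> norm p \<le> b" by (auto simp: bounded_iff)
  have "(\<bar>b\<bar> + 1) *\<^sub>R axis 1 1 \<in> surface G" by (simp add: s axis_def)
  from b[OF this] show False by simp
qed

lemma edges_nonempty: "edges G \<noteq> {}"
proof
  assume "edges G = {}"
  then have "graph_image G = {}" by (simp add: graph_image_eq)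
  then have "\<Union> (faces G) = sphere 0 1" using Union_faces surface_sphere by simp
  then have "axis 1 1 \<in> \<Union> (faces G)" by simp
  then obtain f where "f \<in> faces G" by auto
  then have "0 < face_degree G f" using degree_ge_3(2) by force
  then show False using \<open>edges G = {}\<close> by (simp add: face_degree_def)
qed

lemma verts_nonempty: "verts G \<noteq> {}"
  using edges_nonempty edge_subset card_edge by fastforce

lemma faces_nonempty: "faces G \<noteq> {}"
  using edges_nonempty card_faces_at by (fastforce simp: faces_at_def)

lemma edge_on_face: "e \<in> edges G \<Longrightarrow> \<exists>f\<in>faces G. edge_image G e \<subseteq> closure f"
proof -
  assume "e \<in> edges G"
  then have "faces_at G e \<noteq> {}" using card_faces_at[of e] by auto
  then show ?thesis by (auto simp: faces_at_def)
qed

lemma sphere_covered: "sphere 0 1 = (\<Union>f\<in>faces G. closure f)"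
proof
  show "(\<Union>f\<in>faces G. closure f) \<subseteq> sphere 0 1"
    using face_surface surface_sphere closure_minimal[OF _ closed_sphere] by (metis UN_least)
  show "sphere 0 1 \<subseteq> (\<Union>f\<in>faces G. closure f)"
  proof
    fix p assume p: "p \<in> sphere (0 :: real^3) 1"
    show "p \<in> (\<Union>f\<in>faces G. closure f)"
    proof (cases "p \<in> graph_image G")
      case True
      then show ?thesis using edge_on_face unfolding graph_image_eq by blast
    next
      case False
      then have "p \<in> \<Union> (faces G)" using p Union_faces surface_sphere by auto
      then show ?thesis using closure_subset by blast
    qed
  qed
qed

lemma openin_face: "f \<in> faces G \<Longrightarrow> openin (top_of_set (sphere 0 1)) f"
proof -
  assume f: "f \<in> faces G"
  have o: "openin (top_of_set (sphere 0 1)) (surface G - graph_image G)"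
    unfolding surface_sphere Diff_eq
    using compact_graph_image by (intro openin_open_Int) (simp add: compact_imp_closed open_Compl)
  then have "locally connected (surface G - graph_image G)"
    using locally_connected_sphere by (rule locally_open_subset[rotated])
  then have "openin (top_of_set (surface G - graph_image G)) f"
    using f unfolding faces_def by (rule openin_components_locally_connected)
  then show ?thesis using o by (rule openin_trans)
qed

text \<open>
  A face is open in the sphere, so it does not meet the closure of a set that is disjoint from it.
\<close>

lemma face_Int_closure: "f \<in> faces G \<Longrightarrow> g \<in> faces G \<Longrightarrow> f \<noteq> g \<Longrightarrow> f \<inter> closure g = {}"
proof -
  assume fg: "f \<in> faces G" "g \<in> faces G" "f \<noteq> g"
  obtain T where T: "open T" "f = sphere 0 1 \<inter> T"
    using openin_face[OF fg(1)] by (auto simp: openin_open)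
  have "T \<inter> g = {}" using faces_disjoint[OF fg] T face_surface[OF fg(2)] surface_sphere by blast
  then have "T \<inter> closure g = {}" using T(1) by (simp add: open_Int_closure_eq_empty)
  then show ?thesis using T by blast
qed

lemma closure_faces_Int:
  assumes "f \<in> faces G" "g \<in> faces G" "f \<noteq> g" "p \<in> closure f" "p \<in> closure g"
  shows "(\<exists>e\<in>face_boundary G f. p \<in> edge_image G e) \<and> (\<exists>e\<in>face_boundary G g. p \<in> edge_image G e)"
proof -
  have "p \<in> closure f - f" "p \<in> closure g - g"
    using face_Int_closure[of f g] face_Int_closure[of g f] assms by auto
  then show ?thesis using face_disk(3) assms(1,2) by blast
qed

text \<open>
  A closed face that contains an inner point of an edge contains the edge: the point lies on some
  boundary edge of the face, and two edges have no inner point in common.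
\<close>

lemma edge_in_face_boundary:
  assumes "f \<in> faces G" "e \<in> edges G" "p \<in> edge_image G e" "p \<in> closure f" "p \<notin> pos G ` verts G"
  shows "e \<in> face_boundary G f"
proof -
  have "p \<notin> f" using face_disjoint_graph[OF assms(1)] edge_image_subset_graph[OF assms(2)] assms(3) by blast
  then obtain e' where "e' \<in> face_boundary G f" "p \<in> edge_image G e'"
    using face_disk(3)[OF assms(1)] assms(4) by blast
  moreover have "e = e'"
    using edges_eq_if_common_point[of e e' p] assms calculation face_boundary_subset by blast
  ultimately show ?thesis by simp
qed

lemma arc_minus_endpoint:
  fixes g :: "real \<Rightarrow> 'b::t2_space"
  assumes "arc g" "x = pathstart g \<or> x = pathfinish g"
  shows "connected (path_image g - {x}) \<and> x \<in> closure (path_image g - {x})"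
proof -
  have *: "connected (path_image g - {x}) \<and> x \<in> closure (path_image g - {x})"
    if g: "arc g" "x = pathstart g" for g :: "real \<Rightarrow> 'b" and x
  proof -
    have cont: "continuous_on {0..1} g" and inj: "inj_on g {0..1}" using g by (auto simp: arc_def path_def)
    have eq: "path_image g - {x} = g ` {0<..1}"
    proof -
      have "path_image g - {x} = g ` ({0..1} - {0})"
        using inj_on_image_set_diff[OF inj, of "{0..1}" "{0}"] g by (auto simp: path_image_def pathstart_def)
      also have "{0..1} - {0} = {0<..(1::real)}" by auto
      finally show ?thesis .
    qed
    have "connected (g ` {0<..1})"
      by (intro connected_continuous_image continuous_on_subset[OF cont]) auto
    moreover have "g ` closure {0<..1} \<subseteq> closure (g ` {0<..1})"
      by (rule image_closure_subset) (auto simp: closure_subset cont)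
    then have "g 0 \<in> closure (g ` {0<..1})" by auto
    ultimately show ?thesis using g eq by (simp add: pathstart_def)
  qed
  show ?thesis using *[of g x] *[of "reversepath g" x] assms by (auto simp: arc_reversepath)
qed

lemma infinite_edge_image: "e \<in> edges G \<Longrightarrow> infinite (edge_image G e)"
proof
  assume e: "e \<in> edges G" and "finite (edge_image G e)"
  then have "finite (curve G e ` {0..1})" by (simp add: edge_image_def path_image_def)
  moreover have "inj_on (curve G e) {0..1}" using arc_curve[OF e] by (simp add: arc_def)
  ultimately have "finite {0..1::real}" by (rule finite_imageD)
  then show False by (simp add: infinite_Icc)
qed

text \<open>
  The boundary of a face is a circle divided into arcs by its edges. None of them is the whole
  circle, because a face has at least three edges and two edges have at most one point in common.
\<close>

lemma face_vertex_degree: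
  assumes f: "f \<in> faces G" and x: "x \<in> verts G" "pos G x \<in> closure f"
  shows "card {e \<in> face_boundary G f. x \<in> e} = 2"
proof -
  have bd: "e \<in> edges G" if "e \<in> face_boundary G f" for e using that face_boundary_subset by blast
  have xb: "pos G x \<in> closure f - f"
    using face_disjoint_graph[OF f] x by (auto simp: graph_image_def)
  obtain \<gamma> where \<gamma>: "simple_path \<gamma>" "path_image \<gamma> = closure f - f" "pathstart \<gamma> = pos G x" "pathfinish \<gamma> =
      pos G x"
    using circle_loop_at[OF face_disk(2)[OF f] xb] .
  have "card {e \<in> face_boundary G f. pos G x \<in> edge_image G e} = 2"
  proof (rule loop_two_pieces[OF \<gamma>(1,3,4)])
    show "finite (face_boundary G f)" by (rule finite_face_boundary)
    show "path_image \<gamma> = (\<Union>e\<in>face_boundary G f. edge_image G e)" using \<gamma>(2) face_disk(3)[OF f] by simp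
    show "closed (edge_image G e)" if "e \<in> face_boundary G f" for e
      using closed_edge_image bd that by blast
    show "connected (edge_image G e - {pos G x}) \<and> pos G x \<in> closure (edge_image G e - {pos G x})"
      if e: "e \<in> face_boundary G f" "pos G x \<in> edge_image G e" for e
      unfolding edge_image_def
    proof (rule arc_minus_endpoint)
      show "arc (curve G e)" using arc_curve bd e by blast
      have "pos G x \<in> pos G ` e" using e x pos_in_edge_image bd by blast
      then show "pos G x = pathstart (curve G e) \<or> pos G x = pathfinish (curve G e)"
        using curve_ends[OF bd[OF e(1)]] by blast
    qed
    show "edge_image G e \<inter> edge_image G e' = {pos G x}"
      if e: "e \<in> face_boundary G f" "e' \<in> face_boundary G f" "e \<noteq> e'" "pos G x \<in> edge_image G e"
          "pos G x \<in> edge_image G e'" for e e'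
    proof -
      have xe: "x \<in> e" "x \<in> e'" using e x pos_in_edge_image bd by blast+
      obtain u v where "e = {u, v}" "u \<noteq> v" using card_edge[OF bd[OF e(1)]] by (auto simp: card_2_iff)
      moreover obtain u' v' where "e' = {u', v'}" "u' \<noteq> v'" using card_edge[OF bd[OF e(2)]]
          by (auto simp: card_2_iff)
      ultimately have "e \<inter> e' = {x}" using xe e(3) by auto
      then show ?thesis using edge_image_Int[OF bd[OF e(1)] bd[OF e(2)] e(3)] e by auto
    qed
    show "edge_image G e \<noteq> path_image \<gamma>" if e: "e \<in> face_boundary G f" for e
    proof
      assume eq: "edge_image G e = path_image \<gamma>"
      have "\<not> face_boundary G f \<subseteq> {e}"
      proof
        assume "face_boundary G f \<subseteq> {e}"
        then have "card (face_boundary G f) \<le> card {e}" by (intro card_mono) auto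
        then show False using degree_ge_3(2)[OF f] by (simp add: face_degree_eq)
      qed
      then obtain e' where e': "e' \<in> face_boundary G f" "e' \<noteq> e" by blast
      then have "edge_image G e' \<subseteq> edge_image G e"
        unfolding eq \<gamma>(2) face_disk(3)[OF f] by blast
      then have "edge_image G e' \<subseteq> pos G ` (e' \<inter> e)" using edge_image_Int[of e' e] bd e e' by blast
      moreover have "finite (pos G ` (e' \<inter> e))"
        using edge_subset[OF bd[OF e]] finite_verts by (meson finite_Int finite_imageI finite_subset)
      ultimately show False using infinite_edge_image[OF bd[OF e'(1)]] finite_subset by blast
    qed
  qed
  moreover have "{e \<in> face_boundary G f. pos G x \<in> edge_image G e} = {e \<in> face_boundary G f. x \<in> e}"
    using pos_in_edge_image x bd by blast
  ultimately show ?thesis by simp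
qed

lemma face_boundary_vertex: "e \<in> face_boundary G f \<Longrightarrow> x \<in> e \<Longrightarrow> pos G x \<in> closure f"
  using edge_image_Int_verts[of e] by (auto simp: face_boundary_def)

lemma even_face_vertex_degree:
  assumes f: "f \<in> faces G" and x: "x \<in> verts G"
  shows "even (card {e \<in> face_boundary G f. x \<in> e})"
proof (cases "pos G x \<in> closure f")
  case True
  then show ?thesis using face_vertex_degree[OF f x] by simp
next
  case False
  then have "{e \<in> face_boundary G f. x \<in> e} = {}" using face_boundary_vertex by blast
  then show ?thesis by (simp only: card.empty even_zero)
qed

text \<open>
  Double counting of the incidences between vertices and edges of one face: each vertex is on two
  edges, and each edge has two ends.
\<close>

lemma card_face_verts:
  assumes f: "f \<in> faces G"
  shows "card {x \<in> verts G. pos G x \<in> closure f} = face_degree G f"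
proof -
  let ?C = "{x \<in> verts G. pos G x \<in> closure f}"
  have "(\<Sum>x\<in>?C. card {e \<in> face_boundary G f. x \<in> e}) = (\<Sum>e\<in>face_boundary G f. card (e \<inter> ?C))"
    using sum_card_incident[of ?C "face_boundary G f" "\<lambda>e. e"] finite_verts finite_face_boundary by simp
  also have "\<dots> = (\<Sum>e\<in>face_boundary G f. 2)"
  proof (rule sum.cong)
    fix e assume e: "e \<in> face_boundary G f"
    then have "e \<in> edges G" using face_boundary_subset by blast
    moreover have "e \<inter> ?C = e" using e edge_subset[OF calculation] face_boundary_vertex[OF e] by blast
    ultimately show "card (e \<inter> ?C) = 2" using card_edge by simp
  qed simp
  finally show ?thesis using face_vertex_degree[OF f] by (simp add: face_degree_eq)
qed

section \<open>Euler's formula\<close>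

text \<open>
  The boundary of each face is connected, so its edges belong to one component of the graph.
  Closed faces that belong to different components are disjoint, because distinct closed faces
  meet on boundary edges of both only. As the sphere is connected, there is one component.
\<close>

lemma primal_connected:
  assumes "x \<in> verts G" "y \<in> verts G"
  shows "y \<in> reach (\<lambda>e. e) (edges G) x"
proof (rule ccontr)
  assume y: "y \<notin> reach (\<lambda>e. e) (edges G) x"
  let ?R = "reach (\<lambda>e. e) (edges G) x"
  \<comment> \<open>No edge has just one end in the component of \<open>x\<close>, so \<open>E1\<close> and \<open>E2\<close> make up all edges.\<close>
  define E1 E2 where "E1 = {e \<in> edges G. e \<subseteq> ?R}" and "E2 = {e \<in> edges G. e \<inter> ?R = {}}"
  have E12: "edges G = E1 \<union> E2"
  proof -
    have "e \<subseteq> ?R" if "e \<in> edges G" "e \<inter> ?R \<noteq> {}" for e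
      using that reach_step[of _ "\<lambda>e. e" "edges G" x e] by blast
    then show ?thesis by (auto simp: E1_def E2_def)
  qed
  have disj: "edge_image G e \<inter> edge_image G e' = {}" if "e \<in> E1" "e' \<in> E2" for e e'
  proof -
    have "e \<inter> e' = {}" using that by (auto simp: E1_def E2_def)
    moreover have "e \<noteq> e'" using calculation that card_edge by (fastforce simp: E1_def)
    ultimately show ?thesis using edge_image_Int[of e e'] that by (auto simp: E1_def E2_def)
  qed
  have one: "face_boundary G f \<subseteq> E1 \<or> face_boundary G f \<subseteq> E2" if f: "f \<in> faces G" for f
  proof (rule ccontr)
    assume *: "\<not> ?thesis"
    let ?A = "\<Union>e\<in>face_boundary G f \<inter> E1. edge_image G e" and ?B = "\<Union>e\<in>face_boundary G f \<inter> E2. edge_image G e"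
    have "connected (sphere (0::real^2) 1)" by (rule connected_sphere) simp
    then have "connected (closure f - f)"
      using homeomorphic_connectedness[OF face_disk(2)[OF f]] by simp
    moreover have "closed ?A" "closed ?B"
      using finite_face_boundary closed_edge_image face_boundary_subset by (auto intro!: closed_UN)
    moreover have "closure f - f \<subseteq> ?A \<union> ?B"
      unfolding face_disk(3)[OF f] using E12 face_boundary_subset by blast
    moreover have "?A \<inter> ?B \<inter> (closure f - f) = {}" using disj by blast
    moreover have "?A \<inter> (closure f - f) \<noteq> {}" "?B \<inter> (closure f - f) \<noteq> {}"
    proof -
      obtain e1 e2 where e: "e1 \<in> face_boundary G f" "e1 \<in> E1" "e2 \<in> face_boundary G f" "e2 \<in> E2"
        using * E12 face_boundary_subset by blast
      then have "edge_image G e1 \<noteq> {}" "edge_image G e2 \<noteq> {}"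
        using infinite_edge_image face_boundary_subset by (metis finite.emptyI subsetD)+
      then show "?A \<inter> (closure f - f) \<noteq> {}" "?B \<inter> (closure f - f) \<noteq> {}"
        unfolding face_disk(3)[OF f] using e by blast+
    qed
    ultimately show False using connected_closedD by metis
  qed
  define X where "X = (\<lambda>E. \<Union>f\<in>{f \<in> faces G. face_boundary G f \<subseteq> E}. closure f)"
  have "closed (X E)" for E unfolding X_def using finite_faces by (intro closed_UN) auto
  moreover have "connected (sphere (0::real^3) 1)" by (rule connected_sphere) simp
  moreover have "sphere 0 1 \<subseteq> X E1 \<union> X E2" unfolding X_def sphere_covered using one by blast
  moreover have "X E1 \<inter> X E2 \<inter> sphere 0 1 = {}"
  proof (rule ccontr)
    assume "X E1 \<inter> X E2 \<inter> sphere 0 1 \<noteq> {}"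
    then obtain p f g where fg: "f \<in> faces G" "g \<in> faces G" "face_boundary G f \<subseteq> E1" "face_boundary G g \<subseteq> E2"
      "p \<in> closure f" "p \<in> closure g" by (auto simp: X_def)
    have "face_boundary G f \<noteq> {}" using degree_ge_3(2)[OF fg(1)] by (auto simp: face_degree_eq)
    then have "f \<noteq> g" using fg disj infinite_edge_image face_boundary_subset
      by (metis Int_absorb ex_in_conv finite.emptyI subsetD)
    then show False using closure_faces_Int[OF fg(1,2) _ fg(5,6)] fg disj by blast
  qed
  moreover have "X E1 \<inter> sphere 0 1 \<noteq> {}" "X E2 \<inter> sphere 0 1 \<noteq> {}"
  proof -
    have *: "X E \<inter> sphere 0 1 \<noteq> {}" if e: "e \<in> E" "E = E1 \<or> E = E2" for e E
    proof -
      have eG: "e \<in> edges G" using e E12 by blast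
      obtain f where f: "f \<in> faces G" "edge_image G e \<subseteq> closure f" using edge_on_face[OF eG] by blast
      have "E1 \<inter> E2 = {}" using disj infinite_edge_image E12
        by (metis Int_absorb disjoint_iff finite.emptyI UnI1)
      moreover have "e \<in> face_boundary G f" using f eG by (simp add: face_boundary_def)
      ultimately have "face_boundary G f \<subseteq> E" using one[OF f(1)] e by blast
      then have "closure f \<subseteq> X E" using f by (auto simp: X_def)
      moreover have "closure f \<subseteq> sphere 0 1" using sphere_covered f by blast
      moreover have "closure f \<noteq> {}" using face_nonempty[OF f(1)] by simp
      then obtain p where "p \<in> closure f" by (meson ex_in_conv)
      ultimately have "p \<in> X E \<inter> sphere 0 1" by (meson IntI subsetD)
      then show ?thesis by (metis empty_iff)
    qed
    obtain e1 where "e1 \<in> edges G" "x \<in> e1" using vertex_on_edge assms by blast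
    moreover have "e1 \<notin> E2"
      using \<open>x \<in> e1\<close> reach_refl[of x "\<lambda>e. e" "edges G"] unfolding E2_def by blast
    ultimately have "e1 \<in> E1" using E12 by blast
    then show "X E1 \<inter> sphere 0 1 \<noteq> {}" using * by blast
    obtain e2 where "e2 \<in> edges G" "y \<in> e2" using vertex_on_edge assms by blast
    moreover have "e2 \<notin> E1" using \<open>y \<in> e2\<close> y unfolding E1_def by blast
    ultimately have "e2 \<in> E2" using E12 by blast
    then show "X E2 \<inter> sphere 0 1 \<noteq> {}" using * by blast
  qed
  ultimately show False using connected_closedD by metis
qed

text \<open>
  Closed faces that meet at a point other than a vertex share an edge there. Hence the closed
  faces of two different dual components would disconnect the sphere without the finitely many
  vertices.
\<close>

lemma dual_connected:
  assumes fg: "f \<in> faces G" "g \<in> faces G"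
  shows "g \<in> reach (faces_at G) (edges G) f"
proof (rule ccontr)
  assume g: "g \<notin> reach (faces_at G) (edges G) f"
  let ?R = "reach (faces_at G) (edges G) f"
  let ?S = "sphere 0 1 - pos G ` verts G"
  define A B where "A = (\<Union>f'\<in>faces G \<inter> ?R. closure f')" and "B = (\<Union>f'\<in>faces G - ?R. closure f')"
  have "closed A" "closed B" unfolding A_def B_def using finite_faces by (intro closed_UN; auto)+
  moreover have "connected ?S" using finite_verts by (intro connected_sphere_diff_finite) auto
  moreover have "?S \<subseteq> A \<union> B" unfolding A_def B_def sphere_covered by blast
  moreover have "A \<inter> B \<inter> ?S = {}"
  proof (rule ccontr)
    assume "A \<inter> B \<inter> ?S \<noteq> {}"
    then obtain p f' g' where *: "f' \<in> faces G" "f' \<in> ?R" "g' \<in> faces G" "g' \<notin> ?R" "p \<in> closure f'"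
        "p \<in> closure g'"
      "p \<notin> pos G ` verts G" by (auto simp: A_def B_def)
    then have "f' \<noteq> g'" by blast
    obtain e where e: "e \<in> face_boundary G f'" "p \<in> edge_image G e"
      using closure_faces_Int[OF *(1,3) \<open>f' \<noteq> g'\<close> *(5,6)] by blast
    then have eG: "e \<in> edges G" using face_boundary_subset by blast
    have "e \<in> face_boundary G g'" using edge_in_face_boundary[OF *(3) eG e(2) *(6,7)] .
    then have "f' \<in> faces_at G e" "g' \<in> faces_at G e" using e eG * mem_faces_at_iff by blast+
    then show False using reach_step[OF *(2) eG] *(4) by blast
  qed
  moreover have ne: "closure f' \<inter> ?S \<noteq> {}" if "f' \<in> faces G" for f'
    using face_nonempty[OF that] face_disjoint_graph[OF that] face_surface[OF that] surface_sphere closure_subset[of f']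
    unfolding graph_image_def by blast
  have "A \<inter> ?S \<noteq> {}" "B \<inter> ?S \<noteq> {}"
    using ne[OF fg(1)] ne[OF fg(2)] fg g reach_refl[of f] by (auto simp: A_def B_def)
  ultimately show False using connected_closedD by metis
qed

lemma reach_imp_path_component:
  assumes S: "S \<subseteq> edges G" and "v \<in> reach (\<lambda>e. e) S u" "v \<noteq> u"
  shows "path_component (\<Union>e\<in>S. edge_image G e) (pos G u) (pos G v)"
proof -
  let ?K = "\<Union>e\<in>S. edge_image G e"
  have edge: "path_component ?K (pos G y) (pos G z)" if "e \<in> S" "y \<in> e" "z \<in> e" for e y z
  proof -
    have eG: "e \<in> edges G" using that S by blast
    have "path_connected (edge_image G e)"
      unfolding edge_image_def using arc_curve[OF eG] by (intro path_connected_path_image arc_imp_path)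
    moreover have "pos G y \<in> edge_image G e" "pos G z \<in> edge_image G e"
      using edge_image_Int_verts[OF eG] that by blast+
    ultimately have "path_component (edge_image G e) (pos G y) (pos G z)"
      by (simp add: path_connected_component)
    then show ?thesis using that by (intro path_component_of_subset[of "edge_image G e" ?K]) auto
  qed
  have "(u, v) \<in> (link (\<lambda>e. e) S)\<^sup>*" using assms by (simp add: reach_def)
  then have "v = u \<or> path_component ?K (pos G u) (pos G v)"
  proof (induction rule: rtrancl_induct)
    case (step y z)
    then obtain e where e: "e \<in> S" "y \<in> e" "z \<in> e" by (auto simp: link_def)
    show ?case using step.IH edge[OF e] path_component_trans by metis
  qed simp
  then show ?thesis using assms by simp
qed

text \<open>
  The edge \<open>e\<close> and an arc along edges of \<open>S\<close> between its ends form a simple closed curve, which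
  has two sides. A dual edge that avoids \<open>S\<close> and \<open>e\<close> connects its two faces without crossing this
  curve, so all faces in the dual component of \<open>f\<close> are on the same side. But near an inner point
  of \<open>e\<close> there are no faces other than \<open>f\<close> and \<open>g\<close>, while both sides of the curve come close to
  that point. Hence \<open>f\<close> and \<open>g\<close> lie on different sides.
\<close>

lemma not_dual_reach_if_reach:
  assumes S: "S \<subseteq> edges G" and e: "e \<in> edges G" "e \<notin> S" "e = {u, v}" "faces_at G e = {f, g}"
    and reach: "v \<in> reach (\<lambda>e. e) S u"
  shows "g \<notin> reach (faces_at G) (edges G - S - {e}) f"
proof
  assume g: "g \<in> reach (faces_at G) (edges G - S - {e}) f"
  let ?K = "\<Union>e\<in>S. edge_image G e"
  have uv: "u \<noteq> v" using card_edge[OF e(1)] e(3) by auto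
  have uvG: "u \<in> verts G" "v \<in> verts G" using edge_subset[OF e(1)] e(3) by auto
  have "pos G u \<noteq> pos G v" using inj_pos uv uvG by (auto simp: inj_on_def)
  have "path_component ?K (pos G u) (pos G v)"
    using reach_imp_path_component[OF S reach] uv by simp
  then obtain p0 where p0: "path p0" "path_image p0 \<subseteq> ?K" "pathstart p0 = pos G u" "pathfinish p0 = pos G v"
    by (auto simp: path_component_def)
  obtain c0 where c0: "arc c0" "path_image c0 \<subseteq> path_image p0" "pathstart c0 = pos G u" "pathfinish c0 =
      pos G v"
    using path_contains_arc[OF p0(1,3,4)] \<open>pos G u \<noteq> pos G v\<close> by blast
  have c0K: "path_image c0 \<subseteq> ?K" using c0(2) p0(2) by blast
  obtain d where d: "arc d" "pathstart d = pos G v" "pathfinish d = pos G u" "path_image d = edge_image G e"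
  proof -
    have "{pathstart (curve G e), pathfinish (curve G e)} = {pos G u, pos G v}"
      using curve_ends[OF e(1)] e(3) by simp
    then consider "pathstart (curve G e) = pos G v" "pathfinish (curve G e) = pos G u"
      | "pathstart (curve G e) = pos G u" "pathfinish (curve G e) = pos G v"
      using \<open>pos G u \<noteq> pos G v\<close> by (auto simp: doubleton_eq_iff)
    then show ?thesis
    proof cases
      case 1
      then show ?thesis using that[of "curve G e"] arc_curve[OF e(1)] by (simp add: edge_image_def)
    next
      case 2
      then show ?thesis using that[of "reversepath (curve G e)"] arc_curve[OF e(1)]
        by (simp add: edge_image_def arc_reversepath)
    qed
  qed
  define c where "c = c0 +++ d"
  define C where "C = path_image c0 \<union> edge_image G e"
  have imc: "path_image c = C"
    unfolding c_def C_def using c0 d by (simp add: path_image_join)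
  have "path_image c0 \<inter> path_image d \<subseteq> {pathstart c0, pathstart d}"
  proof
    fix p assume p: "p \<in> path_image c0 \<inter> path_image d"
    then obtain e' where e': "e' \<in> S" "p \<in> edge_image G e'" using c0K by blast
    then have "p \<in> pos G ` (e' \<inter> e)" using edge_image_Int[of e' e] p d(4) e S by blast
    then show "p \<in> {pathstart c0, pathstart d}" using e(3) c0 d by auto
  qed
  then have simple: "simple_path c"
    unfolding c_def using c0 d by (intro simple_path_join_loop) auto
  have loop: "pathfinish c = pathstart c" using c0 d by (simp add: c_def)
  have CG: "C \<subseteq> (\<Union>e\<in>insert e S. edge_image G e)" using c0K by (auto simp: C_def)
  also have "\<dots> \<subseteq> graph_image G" using S e(1) edge_image_subset_graph by blast
  finally have Cgraph: "C \<subseteq> graph_image G" .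
  have fg: "f \<in> faces G" "g \<in> faces G" using e(4) by (auto simp: faces_at_def)
  have graph_sphere: "graph_image G \<subseteq> sphere 0 1"
    unfolding graph_image_eq using edge_image_surface surface_sphere by blast
  obtain p where p: "p \<in> f" using face_nonempty[OF fg(1)] by blast
  have p': "p \<in> sphere 0 1" "p \<notin> path_image c"
    using p face_surface[OF fg(1)] surface_sphere face_disjoint_graph[OF fg(1)] Cgraph imc by blast+
  have "path_image c \<subseteq> sphere 0 1" using Cgraph graph_sphere imc by blast
  then obtain U W where UW: "openin (top_of_set (sphere 0 1)) U" "openin (top_of_set (sphere 0 1)) W"
    "U \<inter> W = {}" "U \<union> W = sphere 0 1 - C" "C \<subseteq> closure U" "C \<subseteq> closure W"
    using Jordan_curve_sphere[OF simple loop _ p'] unfolding imc by metis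
  have one_side: "X \<inter> U = {} \<or> X \<inter> W = {}" if X: "connected X" "X \<subseteq> sphere 0 1 - C" for X
  proof -
    obtain A B where AB: "open A" "open B" "U = sphere 0 1 \<inter> A" "W = sphere 0 1 \<inter> B"
      using UW(1,2) by (auto simp: openin_open)
    have "A \<inter> B \<inter> X = {}" "X \<subseteq> A \<union> B" using AB(3,4) UW(3,4) X(2) by blast+
    then have "A \<inter> X = {} \<or> B \<inter> X = {}" using connectedD[OF X(1) AB(1,2)] by blast
    then show ?thesis using AB by blast
  qed
  have face_out: "h \<subseteq> sphere 0 1 - C" if "h \<in> faces G" for h
    using face_surface[OF that] face_disjoint_graph[OF that] Cgraph surface_sphere by blast
  have "reach (faces_at G) (edges G - S - {e}) f \<subseteq> {h. h \<in> faces G \<and> (h \<subseteq> U \<longleftrightarrow> f \<subseteq> U)}"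
  proof (rule reach_subset)
    show "f \<in> {h. h \<in> faces G \<and> (h \<subseteq> U \<longleftrightarrow> f \<subseteq> U)}" using fg by simp
    fix e' h h' assume e': "e' \<in> edges G - S - {e}" and hh: "h \<in> faces_at G e'" "h' \<in> faces_at G e'"
      and h: "h \<in> {h. h \<in> faces G \<and> (h \<subseteq> U \<longleftrightarrow> f \<subseteq> U)}"
    have h': "h' \<in> faces G" using hh by (simp add: faces_at_def)
    have "infinite (edge_image G e' - pos G ` verts G)"
      using e' infinite_edge_image finite_verts by (intro Diff_infinite_finite) auto
    then obtain q where q: "q \<in> edge_image G e'" "q \<notin> pos G ` verts G"
      by (metis DiffE all_not_in_conv finite.emptyI)
    have "q \<notin> C"
    proof
      assume "q \<in> C"
      then obtain e'' where e'': "e'' \<in> insert e S" "q \<in> edge_image G e''" using CG by blast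
      then have "e' = e''" using edges_eq_if_common_point[of e' e'' q] q e' S e(1) by blast
      then show False using e' e'' by blast
    qed
    moreover have "q \<in> sphere 0 1" using q e' edge_image_subset_graph graph_sphere by blast
    ultimately have sub: "insert q h \<union> insert q h' \<subseteq> sphere 0 1 - C"
      using face_out[of h] face_out[OF h'] h by auto
    have "q \<in> closure h" "q \<in> closure h'" using q hh by (auto simp: faces_at_def)
    then have "connected (insert q h)" "connected (insert q h')"
      using connected_intermediate_closure[of h "insert q h"] connected_intermediate_closure[of h' "insert q h'"]
        face_connected[of h] face_connected[OF h'] h closure_subset[of h] closure_subset[of h'] by blast+
    then have "connected (insert q h \<union> insert q h')" by (intro connected_Un) auto
    from one_side[OF this sub] have "h' \<subseteq> U \<longleftrightarrow> h \<subseteq> U"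
      using face_out[of h] face_out[OF h'] h face_nonempty[of h] face_nonempty[OF h'] UW(3,4) by blast
    then show "h' \<in> {h. h \<in> faces G \<and> (h \<subseteq> U \<longleftrightarrow> f \<subseteq> U)}" using h h' by simp
  qed
  then have gf: "g \<subseteq> U \<longleftrightarrow> f \<subseteq> U" using g by blast
  have "infinite (edge_image G e - pos G ` verts G)"
    using e infinite_edge_image finite_verts by (intro Diff_infinite_finite) auto
  then obtain q where q: "q \<in> edge_image G e" "q \<notin> pos G ` verts G"
    by (metis DiffE all_not_in_conv finite.emptyI)
  \<comment> \<open>The union of all edges and closed faces that are not incident with \<open>e\<close>.\<close>
  define Z where "Z = (\<Union>e'\<in>edges G - {e}. edge_image G e') \<union> (\<Union>h\<in>faces G - {f, g}. closure h)"
  have "closed Z"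
    unfolding Z_def using finite_edges finite_faces closed_edge_image by (intro closed_Un closed_UN) auto
  have "q \<notin> Z"
  proof
    assume "q \<in> Z"
    then consider e' where "e' \<in> edges G - {e}" "q \<in> edge_image G e'"
      | h where "h \<in> faces G - {f, g}" "q \<in> closure h" unfolding Z_def by blast
    then show False
    proof cases
      case 1
      then show False using edges_eq_if_common_point[of e' e q] q e(1) by blast
    next
      case 2
      then have "e \<in> face_boundary G h" using edge_in_face_boundary[of h e q] q e(1) by blast
      then show False using mem_faces_at_iff[of e G h] 2 e(1,4) by blast
    qed
  qed
  have meets: "f \<inter> V \<noteq> {} \<or> g \<inter> V \<noteq> {}" if V: "C \<subseteq> closure V" "V \<subseteq> sphere 0 1 - C" for V
  proof -
    have "q \<in> closure V" using q V(1) by (auto simp: C_def)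
    moreover have "q \<in> - Z" "open (- Z)" using \<open>q \<notin> Z\<close> \<open>closed Z\<close> by auto
    ultimately have "- Z \<inter> V \<noteq> {}" by (metis disjoint_iff open_Int_closure_eq_empty)
    then obtain y where y: "y \<in> V" "y \<notin> Z" by blast
    have "y \<notin> graph_image G"
      using y V(2) unfolding graph_image_eq by (auto simp: Z_def C_def)
    then have "y \<in> \<Union> (faces G)" using y V(2) Union_faces surface_sphere by blast
    then obtain h where h: "h \<in> faces G" "y \<in> h" by blast
    then have "h \<in> {f, g}" using y(2) closure_subset[of h] by (auto simp: Z_def)
    then show ?thesis using h y by blast
  qed
  have sideU: "h \<subseteq> U" if "h \<in> faces G" "h \<inter> U \<noteq> {}" for h
    using one_side[OF face_connected[OF that(1)] face_out[OF that(1)]] face_out[OF that(1)] that UW(4) by blast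
  have "f \<inter> U \<noteq> {} \<or> g \<inter> U \<noteq> {}" using meets[of U] UW by blast
  then have "f \<subseteq> U" "g \<subseteq> U" using sideU fg gf by blast+
  moreover have "f \<inter> W \<noteq> {} \<or> g \<inter> W \<noteq> {}" using meets[of W] UW by blast
  ultimately show False using UW(3) by blast
qed

lemma euler: "card (verts G) + card (faces G) = card (edges G) + 2"
proof (rule euler_from_duality[where pe = "\<lambda>e. e" and de = "faces_at G"])
  show "finite (edges G)" "finite (verts G)" "finite (faces G)"
    by (rule finite_edges finite_verts finite_faces)+
  show pe: "e \<subseteq> verts G \<and> card e = 2" if "e \<in> edges G" for e
    using edge_subset[OF that] card_edge[OF that] by simp
  show de: "faces_at G e \<subseteq> faces G \<and> card (faces_at G e) = 2" if "e \<in> edges G" for e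
    using card_faces_at[OF that] by (auto simp: faces_at_def)
  show "num_classes (\<lambda>e. e) (edges G) (verts G) = 1"
    by (rule num_classes_connected[OF verts_nonempty primal_connected])
  show "num_classes (faces_at G) (edges G) (faces G) = 1"
    by (rule num_classes_connected[OF faces_nonempty dual_connected])
  fix S e u v f g
  assume *: "S \<subseteq> edges G" "e \<in> edges G" "e \<notin> S" "e = {u, v}" "faces_at G e = {f, g}"
  have even: "even (card {e \<in> edges G. f \<in> faces_at G e \<and> card (e \<inter> W) = 1})"
    if f: "f \<in> faces G" and W: "W \<subseteq> verts G" for f W
  proof -
    have "even (card {e \<in> face_boundary G f. card (e \<inter> W) = 1})"
      using even_cut[of "face_boundary G f" W "\<lambda>e. e"] finite_face_boundary finite_subset[OF W finite_verts]
        card_edge face_boundary_subset even_face_vertex_degree[OF f] W by blast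
    moreover have "{e \<in> face_boundary G f. card (e \<inter> W) = 1} =
        {e \<in> edges G. f \<in> faces_at G e \<and> card (e \<inter> W) = 1}"
      using f by (auto simp: face_boundary_def faces_at_def)
    ultimately show ?thesis by simp
  qed
  show "v \<in> reach (\<lambda>e. e) S u \<longleftrightarrow> g \<notin> reach (faces_at G) (edges G - S - {e}) f"
    using not_dual_reach_if_reach[OF *]
      dual_reach_if_not_reach[of "edges G" "verts G" "faces G" "\<lambda>e. e" "faces_at G" S e u v f g,
        OF finite_edges finite_verts finite_faces pe de even *] by blast
qed

lemma sum_face_degree: "(\<Sum>f\<in>faces G. face_degree G f) = 2 * card (edges G)"
proof -
  have "(\<Sum>f\<in>faces G. face_degree G f) = (\<Sum>f\<in>faces G. card {e \<in> edges G. f \<in> faces_at G e})"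
    by (intro sum.cong) (auto simp: face_degree_def faces_at_def intro!: arg_cong[where f = card])
  also have "\<dots> = (\<Sum>e\<in>edges G. card (faces_at G e \<inter> faces G))"
    by (rule sum_card_incident[OF finite_faces finite_edges])
  also have "\<dots> = (\<Sum>e\<in>edges G. 2)"
  proof (rule sum.cong)
    fix e assume e: "e \<in> edges G"
    have "faces_at G e \<inter> faces G = faces_at G e" by (auto simp: faces_at_def)
    then show "card (faces_at G e \<inter> faces G) = 2" using card_faces_at[OF e] by simp
  qed simp
  finally show ?thesis by simp
qed

text \<open>
  The contribution of a face is its interior angle, once for each of its vertices.
\<close>

lemma sum_total_angle:
  "(\<Sum>x\<in>verts G. total_angle a G x) = (\<Sum>f\<in>faces G. real (face_degree G f) * interior_angle (face_degree G f) a)"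
proof -
  have "(\<Sum>x\<in>verts G. total_angle a G x) =
      (\<Sum>f\<in>faces G. \<Sum>x\<in>{x \<in> verts G. pos G x \<in> closure f}. interior_angle (face_degree G f) a)"
    unfolding total_angle_def by (rule sum.swap_restrict[OF finite_verts finite_faces])
  then show ?thesis by (simp add: card_face_verts)
qed

end

theorem theorem1p2:
  fixes G :: "'v embedded_graph" and a :: real
  assumes "finite_planar_graph G"
    and "0 < a"
    and "a \<le> (INF f\<in>faces G. 2 * pi / real (face_degree G f))"
  shows "surface_area a G + (\<Sum>x\<in>verts G. angle_defect a G x) = 4 * pi"
proof -
  note G = assms(1)
  have area: "spherical_area (\<Delta> (face_degree G f) a) =
      real (face_degree G f) * interior_angle (face_degree G f) a - (real (face_degree G f) - 2) * pi"
    if f: "f \<in> faces G" for f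
  proof (rule area_regular_polygon)
    show "3 \<le> face_degree G f" using degree_ge_3(2)[OF G f] .
    have "(INF f\<in>faces G. 2 * pi / real (face_degree G f)) \<le> 2 * pi / real (face_degree G f)"
      using f by (intro cINF_lower bdd_belowI2[where m = 0]) auto
    then show "a \<le> 2 * pi / real (face_degree G f)" using assms(3) by linarith
  qed (rule assms(2))
  define V E F where "V = real (card (verts G))" and "E = real (card (edges G))" and "F = real (card (faces G))"
  define A where "A = (\<Sum>x\<in>verts G. total_angle a G x)"
  have "surface_area a G = A - (\<Sum>f\<in>faces G. (real (face_degree G f) - 2) * pi)"
    unfolding surface_area_def A_def sum_total_angle[OF G] sum_subtractf[symmetric]
    using area by (intro sum.cong) auto
  also have "(\<Sum>f\<in>faces G. (real (face_degree G f) - 2) * pi) = (2 * E - 2 * F) * pi"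
  proof -
    have "(\<Sum>f\<in>faces G. real (face_degree G f)) = 2 * E"
      unfolding E_def using sum_face_degree[OF G] by (metis of_nat_mult of_nat_numeral of_nat_sum)
    then show ?thesis by (simp add: F_def sum_distrib_right[symmetric] sum_subtractf)
  qed
  finally have area_sum: "surface_area a G = A - (2 * E - 2 * F) * pi" .
  have defect_sum: "(\<Sum>x\<in>verts G. angle_defect a G x) = 2 * pi * V - A"
    by (simp add: angle_defect_def sum_subtractf V_def A_def)
  have "surface_area a G + (\<Sum>x\<in>verts G. angle_defect a G x) = 2 * pi * (V + F - E)"
    unfolding area_sum defect_sum by (simp add: algebra_simps)
  also have "V + F - E = 2"
  proof -
    have "V + F = E + 2"
      unfolding V_def E_def F_def using euler[OF G] by (metis of_nat_add of_nat_numeral)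
    then show ?thesis by simp
  qed
  finally show ?thesis by simp
qed

end
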